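(* Let $n$ and $k$ be integers with $n \rightarrow \infty$, $k \leq \frac{n}{2}$ and $k-r=\Theta(n)$, where $c$ and $r$ are the integers such that $n=ck+r$ and $r \in \{0,\ldots,k-1\}$. Then $\mathrm{SP}(n,k)\sim\mathrm{MMS}(n,k)$.
   Context: For integers $n \geq k \geq 1$, an $(n,k)$-Sperner partition system is a set of partitions of some $n$-set such that each partition has exactly $k$ nonempty parts and no part in any partition is a subset of a part in a different partition. $\mathrm{SP}(n,k)$ denotes the maximum number of partitions in an $(n,k)$-Sperner partition system. With $c,r$ the unique integers such that $n=ck+r$ and $r\in\{0,\ldots,k-1\}$, \[\mathrm{MMS}(n,k) = \frac{\binom{n}{c}}{k-r+\frac{r(c+1)}{n-c}}.\] Asymptotic statements are along any sequence of pairs $(n,k)$ (with $k$, and hence $c$ and $r$, allowed to vary with $n$) with $n\to\infty$ satisfying the stated hypotheses; $f\sim g$ means $f/g\to 1$ along the sequence. *)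

theory Defs
  imports Complex_Main "HOL-Library.Disjoint_Sets" "HOL-Library.Landau_Symbols"
begin

(* The parts of a partition_on are nonempty by definition. *)
definition sperner_partition_system :: "nat \<Rightarrow> 'a set \<Rightarrow> 'a set set set \<Rightarrow> bool" where
  "sperner_partition_system k X P \<longleftrightarrow>
     (\<forall>\<pi>\<in>P. partition_on X \<pi> \<and> card \<pi> = k) \<and>
     (\<forall>\<pi>\<in>P. \<forall>\<sigma>\<in>P. \<pi> \<noteq> \<sigma> \<longrightarrow> (\<forall>A\<in>\<pi>. \<forall>B\<in>\<sigma>. \<not> A \<subseteq> B))"

(* The ground set {..<n} is representative of every n-set: see SP_eq_Max below.
   The maximum is over a finite nonempty set: see finite_card_sperner and
   sperner_partition_system_empty. *)
definition SP :: "nat \<Rightarrow> nat \<Rightarrow> nat" where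
  "SP n k = Max {card P | P. sperner_partition_system k {..<n} P}"

definition MMS :: "nat \<Rightarrow> nat \<Rightarrow> real" where
  "MMS n k = (let c = n div k; r = n mod k in
     real (n choose c) /
       (real k - real r + real r * (real c + 1) / (real n - real c)))"

lemma sperner_partition_system_empty: "sperner_partition_system k X {}"
  by (simp add: sperner_partition_system_def)

lemma finite_card_sperner:
  assumes "finite X"
  shows "finite {card P | P. sperner_partition_system k X P}"
proof -
  have "{P. sperner_partition_system k X P} \<subseteq> Pow (Pow (Pow X))"
    by (auto simp: sperner_partition_system_def partition_on_def)
  then have "finite {P. sperner_partition_system k X P}"
    by (rule finite_subset) (use assms in simp)
  then show ?thesis by simp
qed

lemma sperner_partition_system_image:
  fixes f :: "'a \<Rightarrow> 'b"
  assumes f: "bij_betw f X Y" and P: "sperner_partition_system k X P"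
  shows "sperner_partition_system k Y ((`) ((`) f) ` P)"
    and "card ((`) ((`) f) ` P) = card P"
proof -
  have inj: "inj_on f X" and Y: "Y = f ` X"
    using f by (auto simp: bij_betw_def)
  have inj1: "inj_on ((`) f) (Pow X)"
    using inj by (rule inj_on_image_Pow)
  have inj2: "inj_on ((`) ((`) f)) (Pow (Pow X))"
    using inj1 by (rule inj_on_image_Pow)
  have sub: "P \<subseteq> Pow (Pow X)"
    using P by (auto simp: sperner_partition_system_def partition_on_def)
  show "card ((`) ((`) f) ` P) = card P"
    by (rule card_image) (rule inj_on_subset[OF inj2 sub])
  have part: "partition_on Y ((`) f ` \<pi>) \<and> card ((`) f ` \<pi>) = k" if "\<pi> \<in> P" for \<pi>
  proof
    have \<pi>: "partition_on X \<pi>" "card \<pi> = k" "\<pi> \<subseteq> Pow X"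
      using P sub that by (auto simp: sperner_partition_system_def)
    have "partition_on (f ` X) ((`) f ` \<pi> - {{}})"
      using \<pi>(1) inj by (rule partition_on_inj_image)
    moreover have "(`) f ` \<pi> - {{}} = (`) f ` \<pi>"
      using \<pi>(1) by (auto simp: partition_on_def)
    ultimately show "partition_on Y ((`) f ` \<pi>)" by (simp add: Y)
    show "card ((`) f ` \<pi>) = k"
      using \<pi>(2) card_image[OF inj_on_subset[OF inj1 \<pi>(3)]] by simp
  qed
  have "\<not> f ` A \<subseteq> f ` B"
    if "\<pi> \<in> P" "\<sigma> \<in> P" "\<pi> \<noteq> \<sigma>" "A \<in> \<pi>" "B \<in> \<sigma>" for \<pi> \<sigma> A B
  proof -
    have AB: "A \<subseteq> X" "B \<subseteq> X" using sub that by auto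
    have "\<not> A \<subseteq> B" using P that by (auto simp: sperner_partition_system_def)
    then obtain x where x: "x \<in> A" "x \<notin> B" by auto
    with AB have "f x \<notin> f ` B" using inj_on_image_mem_iff[OF inj, of x B] by (simp add: subsetD)
    with x show ?thesis by auto
  qed
  then have "\<forall>\<pi>\<in>P. \<forall>\<sigma>\<in>P. (`) f ` \<pi> \<noteq> (`) f ` \<sigma> \<longrightarrow>
      (\<forall>A\<in>\<pi>. \<forall>B\<in>\<sigma>. \<not> f ` A \<subseteq> f ` B)" by metis
  then show "sperner_partition_system k Y ((`) ((`) f) ` P)"
    using part by (simp add: sperner_partition_system_def)
qed

lemma card_sperner_mono:
  assumes "bij_betw f X Y"
  shows "{card P | P. sperner_partition_system k X P} \<subseteq>
         {card P | P. sperner_partition_system k Y P}"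
proof
  fix m assume "m \<in> {card P | P. sperner_partition_system k X P}"
  then obtain P where P: "m = card P" "sperner_partition_system k X P" by auto
  show "m \<in> {card P | P. sperner_partition_system k Y P}"
    using sperner_partition_system_image[OF assms P(2)] P(1)
    by (intro CollectI exI[of _ "(`) ((`) f) ` P"]) simp
qed

lemma SP_eq_Max:
  fixes X :: "'a set"
  assumes "finite X" "card X = n"
  shows "SP n k = Max {card P | P. sperner_partition_system k X P}"
proof -
  obtain f where f: "bij_betw f X {..<n}"
    using assms finite_same_card_bij[of X "{..<n}"] by auto
  then obtain g where g: "bij_betw g {..<n} X"
    using bij_betw_inv by blast
  have "{card P | P. sperner_partition_system k {..<n} P} =
        {card P | P. sperner_partition_system k X P}"
    by (rule equalityI[OF card_sperner_mono[OF g] card_sperner_mono[OF f]])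
  then show ?thesis by (simp add: SP_def)
qed

end

theory Submission
  imports Defs
begin

text \<open>
  The upper bound \<open>SP n k \<le> MMS n k\<close> is the LYM inequality applied to the antichain of all parts,
  together with the convexity of \<open>j \<mapsto> 1 / (n choose j)\<close>.

  For the lower bound, colour the ground set with a large constant number \<open>t\<close> of colours, in
  classes of nearly equal size. Almost all \<open>c\<close>-sets have at most one point of each colour, and none
  of them lies in a monochromatic \<open>(c+1)\<close>-set. So it suffices to find many partitions, each with
  \<open>k - r\<close> such \<open>c\<close>-sets and \<open>r\<close> monochromatic \<open>(c+1)\<close>-sets, in which no set is repeated. These exist
  by a version of Baranyai's theorem for coloured ground sets, which follows the proof of Brouwer
  and Schrijver: the points are placed one at a time, each time rounding a fractional solution of
  a transportation problem. Monochromatic \<open>(c+1)\<close>-sets are plentiful, there being of order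
  \<open>n ^ (c + 1)\<close> of them, so only the number of \<open>c\<close>-sets limits the number of partitions, which
  therefore is about \<open>(n choose c) / (k - r)\<close>; and \<open>MMS n k\<close> is at most this.
\<close>

subsection \<open>Rounding fractional assignments\<close>

lemma distinct_path_of_rtranclp:
  assumes "R\<^sup>*\<^sup>* x y"
  shows "\<exists>xs. distinct (x # xs) \<and> last (x # xs) = y \<and> successively R (x # xs)"
  using assms
proof (induction rule: converse_rtranclp_induct)
  case base
  show ?case by (intro exI[of _ "[]"]) simp
next
  case (step x z)
  then obtain zs where zs: "distinct (z # zs)" "last (z # zs) = y" "successively R (z # zs)"
    by blast
  show ?case
  proof (cases "x \<in> set (z # zs)")
    case True
    then obtain as bs where "z # zs = as @ x # bs" by (meson split_list)
    with zs show ?thesis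
      by (intro exI[of _ bs]) (auto simp: successively_append_iff)
  next
    case False
    with zs step.hyps show ?thesis by (intro exI[of _ "z # zs"]) auto
  qed
qed

lemma card_fibre_fun_upd:
  assumes "finite I" "i0 \<in> I"
  shows "int (card {i\<in>I. (h(i0 := y)) i = l}) =
    int (card {i\<in>I. h i = l}) - of_bool (l = h i0) + of_bool (l = y)"
proof -
  have *: "int (card {i\<in>I. f i = l}) = (\<Sum>i\<in>I. of_bool (f i = l))" for f
    using assms(1) by (simp add: of_bool_def sum.If_cases Int_def)
  have "(\<Sum>i\<in>I. of_bool ((h(i0 := y)) i = l)) =
     of_bool (y = l) + (\<Sum>i\<in>I-{i0}. of_bool (h i = l) :: int)"
    using assms by (subst sum.remove[of _ i0]) (auto intro!: sum.cong)
  moreover have "(\<Sum>i\<in>I. of_bool (h i = l) :: int) =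
     of_bool (h i0 = l) + (\<Sum>i\<in>I-{i0}. of_bool (h i = l))"
    using assms by (subst sum.remove[of _ i0]) auto
  ultimately show ?thesis unfolding * by auto
qed

lemma reassign_along_path:
  assumes "finite I" "\<forall>i\<in>I. h i \<in> A i"
    and "distinct (x # xs)" "successively (\<lambda>l l'. \<exists>i\<in>I. h i = l \<and> l' \<in> A i) (x # xs)"
  shows "\<exists>h'. (\<forall>i\<in>I. h' i \<in> A i) \<and> (\<forall>i\<in>I. h i \<notin> set (x # xs) \<longrightarrow> h' i = h i) \<and>
    (\<forall>l. int (card {i\<in>I. h' i = l}) =
       int (card {i\<in>I. h i = l}) - of_bool (l = x) + of_bool (l = last (x # xs)))"
  using assms(3,4)
proof (induction xs arbitrary: x)
  case Nil
  show ?case using assms(2) by (intro exI[of _ h]) simp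
next
  case (Cons y ys)
  obtain h' where h': "\<forall>i\<in>I. h' i \<in> A i" "\<forall>i\<in>I. h i \<notin> set (y # ys) \<longrightarrow> h' i = h i"
    "\<forall>l. int (card {i\<in>I. h' i = l}) =
       int (card {i\<in>I. h i = l}) - of_bool (l = y) + of_bool (l = last (y # ys))"
    using Cons.IH[of y] Cons.prems by auto
  obtain i0 where i0: "i0 \<in> I" "h i0 = x" "y \<in> A i0"
    using Cons.prems by auto
  have "h' i0 = x" using h'(2) i0 Cons.prems by auto
  then have "int (card {i\<in>I. (h'(i0 := y)) i = l}) =
      int (card {i\<in>I. h i = l}) - of_bool (l = x) + of_bool (l = last (x # y # ys))" for l
    using card_fibre_fun_upd[OF assms(1) i0(1), of h' y l] h'(3) by simp
  moreover have "\<forall>i\<in>I. (h'(i0 := y)) i \<in> A i" using h'(1) i0 by auto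
  moreover have "\<forall>i\<in>I. h i \<notin> set (x # y # ys) \<longrightarrow> (h'(i0 := y)) i = h i"
    using h'(2) i0 by auto
  ultimately show ?case by (intro exI[of _ "h'(i0 := y)"]) blast
qed

lemma card_preimage_eq_sum:
  assumes "finite I" "finite R"
  shows "card {i\<in>I. h i \<in> R} = (\<Sum>l\<in>R. card {i\<in>I. h i = l})"
proof -
  have "{i\<in>I. h i \<in> R} = (\<Union>l\<in>R. {i\<in>I. h i = l})" by auto
  then show ?thesis using assms by (simp add: card_UN_disjoint disjoint_iff)
qed

text \<open>Take \<open>h\<close> with the least total violation of the bounds. From an overfull class, some
  reachable class has spare capacity, for otherwise the fractional mass contained in the reachable
  set would exceed its upper bounds; reassigning along a path lowers the violation. Dually for an
  underfull class.\<close>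

lemma integral_rounding:
  fixes w :: "'i \<Rightarrow> 'l \<Rightarrow> real" and b u :: "'l \<Rightarrow> nat"
  assumes fin: "finite I" "finite L"
    and nonneg: "\<And>i l. i \<in> I \<Longrightarrow> l \<in> L \<Longrightarrow> 0 \<le> w i l"
    and sum1: "\<And>i. i \<in> I \<Longrightarrow> (\<Sum>l\<in>L. w i l) = 1"
    and lower: "\<And>l. l \<in> L \<Longrightarrow> real (b l) \<le> (\<Sum>i\<in>I. w i l)"
    and upper: "\<And>l. l \<in> L \<Longrightarrow> (\<Sum>i\<in>I. w i l) \<le> real (u l)"
  obtains h where "\<And>i. i \<in> I \<Longrightarrow> h i \<in> L \<and> 0 < w i (h i)"
    and "\<And>l. l \<in> L \<Longrightarrow> b l \<le> card {i\<in>I. h i = l} \<and> card {i\<in>I. h i = l} \<le> u l"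
proof -
  define A where "A i = {l\<in>L. 0 < w i l}" for i
  define cnt where "cnt h l = card {i\<in>I. h i = l}" for h :: "'i \<Rightarrow> 'l" and l
  define \<Phi> where "\<Phi> h = (\<Sum>l\<in>L. (cnt h l - u l) + (b l - cnt h l))" for h
  have zero: "w i l = 0" if "i \<in> I" "l \<in> L" "l \<notin> A i" for i l
    using nonneg[of i l] that by (force simp: A_def)
  have "\<exists>l. l \<in> A i" if i: "i \<in> I" for i
  proof (rule ccontr)
    assume "\<nexists>l. l \<in> A i"
    then have "(\<Sum>l\<in>L. w i l) = 0" using zero[OF i] by (intro sum.neutral) auto
    with sum1[OF i] show False by simp
  qed
  then obtain h0 where "\<forall>i\<in>I. h0 i \<in> A i" by metis
  from ex_has_least_nat[where P="\<lambda>h. \<forall>i\<in>I. h i \<in> A i", OF this, of \<Phi>]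
  obtain h where h: "\<forall>i\<in>I. h i \<in> A i" and
    least: "\<And>h'. \<forall>i\<in>I. h' i \<in> A i \<Longrightarrow> \<Phi> h \<le> \<Phi> h'" by auto
  have bu: "b l \<le> u l" if "l \<in> L" for l
    using lower[OF that] upper[OF that] by linarith
  define E where "E = (\<lambda>l l'. \<exists>i\<in>I. h i = l \<and> l' \<in> A i)"
  have closedL: "l' \<in> L" if "E\<^sup>*\<^sup>* l l'" "l \<in> L" for l l'
    using that by (induction rule: rtranclp_induct) (auto simp: E_def A_def)
  have no_improve: False
    if xz: "E\<^sup>*\<^sup>* x z" "x \<in> L" "x \<noteq> z" and a: "b x < cnt h x" "cnt h z < u z"
      and strict: "u x < cnt h x \<or> cnt h z < b z" for x z
  proof -
    obtain xs where "distinct (x # xs)" "last (x # xs) = z" "successively E (x # xs)"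
      using distinct_path_of_rtranclp[OF xz(1)] by blast
    with reassign_along_path[OF fin(1) h, of x xs] obtain h' where
      h': "\<forall>i\<in>I. h' i \<in> A i"
      "\<forall>l. int (cnt h' l) = int (cnt h l) - of_bool (l = x) + of_bool (l = z)"
      unfolding E_def cnt_def by auto
    have zL: "z \<in> L" using closedL xz by blast
    have cx: "cnt h' x = cnt h x - 1" using h'(2)[rule_format, of x] xz(3) by simp
    have cz: "cnt h' z = cnt h z + 1" using h'(2)[rule_format, of z] xz(3) by simp
    have co: "cnt h' l = cnt h l" if "l \<noteq> x" "l \<noteq> z" for l using h'(2)[rule_format, of l] that by simp
    have "\<Phi> h' < \<Phi> h" unfolding \<Phi>_def
    proof (rule sum_strict_mono_ex1[OF fin(2)])
      show "\<forall>l\<in>L. cnt h' l - u l + (b l - cnt h' l) \<le> cnt h l - u l + (b l - cnt h l)"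
      proof
        fix l assume "l \<in> L"
        show "cnt h' l - u l + (b l - cnt h' l) \<le> cnt h l - u l + (b l - cnt h l)"
          using cx cz co[of l] a by (cases "l = x"; cases "l = z") auto
      qed
      have "cnt h' x - u x + (b x - cnt h' x) < cnt h x - u x + (b x - cnt h x)" if "u x < cnt h x"
        using that cx bu[OF xz(2)] by auto
      moreover have "cnt h' z - u z + (b z - cnt h' z) < cnt h z - u z + (b z - cnt h z)" if "cnt h z < b z"
        using that cz bu[OF zL] by auto
      ultimately show "\<exists>l\<in>L. cnt h' l - u l + (b l - cnt h' l) < cnt h l - u l + (b l - cnt h l)"
        using strict xz(2) zL by blast
    qed
    with least[OF h'(1)] show False by simp
  qed
  have le_u: "cnt h x \<le> u x" if x: "x \<in> L" for x
  proof (rule ccontr)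
    assume "\<not> cnt h x \<le> u x"
    then have over: "u x < cnt h x" by simp
    define R where "R = {z. E\<^sup>*\<^sup>* x z}"
    have RL: "R \<subseteq> L" using closedL x by (auto simp: R_def)
    then have finR: "finite R" using fin(2) finite_subset by blast
    have xR: "x \<in> R" by (simp add: R_def)
    have sat: "u z \<le> cnt h z" if "z \<in> R" for z
      using no_improve[of x z] that over x bu[OF x] by (cases "x = z") (auto simp: R_def not_less[symmetric])
    have AR: "A i \<subseteq> R" if "i \<in> I" "h i \<in> R" for i
      using that by (auto simp: R_def E_def intro: rtranclp.rtrancl_into_rtrancl)
    have "(\<Sum>z\<in>R. real (cnt h z)) = real (card {i\<in>I. h i \<in> R})"
      using card_preimage_eq_sum[OF fin(1) finR, of h] by (simp add: cnt_def)
    also have "\<dots> = (\<Sum>i | i \<in> I \<and> h i \<in> R. \<Sum>l\<in>L. w i l)"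
      using sum1 by simp
    also have "\<dots> = (\<Sum>i | i \<in> I \<and> h i \<in> R. \<Sum>l\<in>R. w i l)"
    proof (rule sum.cong[OF refl])
      fix i assume "i \<in> {i\<in>I. h i \<in> R}"
      then have "\<forall>l\<in>L - R. w i l = 0" using AR[of i] zero[of i] by blast
      then show "(\<Sum>l\<in>L. w i l) = (\<Sum>l\<in>R. w i l)"
        by (rule sum.mono_neutral_right[OF fin(2) RL])
    qed
    also have "\<dots> \<le> (\<Sum>i\<in>I. \<Sum>l\<in>R. w i l)"
      using fin(1) nonneg RL by (intro sum_mono2) (auto intro!: sum_nonneg)
    also have "\<dots> = (\<Sum>l\<in>R. \<Sum>i\<in>I. w i l)" by (rule sum.swap)
    also have "\<dots> \<le> (\<Sum>l\<in>R. real (u l))" using upper RL by (intro sum_mono) auto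
    also have "\<dots> < (\<Sum>l\<in>R. real (cnt h l))"
      using sat over xR finR by (intro sum_strict_mono_ex1) auto
    finally show False by simp
  qed
  have b_le: "b z \<le> cnt h z" if z: "z \<in> L" for z
  proof (rule ccontr)
    assume "\<not> b z \<le> cnt h z"
    then have under: "cnt h z < b z" by simp
    define R where "R = {x\<in>L. E\<^sup>*\<^sup>* x z}"
    have RL: "R \<subseteq> L" by (auto simp: R_def)
    then have finR: "finite R" using fin(2) finite_subset by blast
    have zR: "z \<in> R" by (simp add: R_def z)
    have sat: "cnt h x \<le> b x" if "x \<in> R" for x
      using no_improve[of x z] that under bu[OF z] by (cases "x = z") (auto simp: R_def not_less[symmetric])
    have AR: "A i \<inter> R = {}" if "i \<in> I" "h i \<notin> R" for i
      using that h by (auto simp: R_def E_def A_def intro: converse_rtranclp_into_rtranclp)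
    have "(\<Sum>l\<in>R. real (cnt h l)) < (\<Sum>l\<in>R. real (b l))"
      using sat under zR finR by (intro sum_strict_mono_ex1) auto
    also have "\<dots> \<le> (\<Sum>l\<in>R. \<Sum>i\<in>I. w i l)" using lower RL by (intro sum_mono) auto
    also have "\<dots> = (\<Sum>i\<in>I. \<Sum>l\<in>R. w i l)" by (rule sum.swap)
    also have "\<dots> = (\<Sum>i | i \<in> I \<and> h i \<in> R. \<Sum>l\<in>R. w i l)"
    proof (intro sum.mono_neutral_right ballI)
      fix i assume "i \<in> I - {i\<in>I. h i \<in> R}"
      then show "(\<Sum>l\<in>R. w i l) = 0"
        using AR[of i] zero[of i] RL by (intro sum.neutral) blast
    qed (use fin in auto)
    also have "\<dots> \<le> (\<Sum>i | i \<in> I \<and> h i \<in> R. \<Sum>l\<in>L. w i l)"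
      using nonneg RL fin by (intro sum_mono sum_mono2) auto
    also have "\<dots> = real (card {i\<in>I. h i \<in> R})" using sum1 by simp
    also have "\<dots> = (\<Sum>z\<in>R. real (cnt h z))"
      using card_preimage_eq_sum[OF fin(1) finR, of h] by (simp add: cnt_def)
    finally show False by simp
  qed
  show thesis
    using that[of h] h le_u b_le by (auto simp: A_def cnt_def)
qed

subsection \<open>Baranyai's theorem for a coloured ground set\<close>

lemma prod_choose_take:
  fixes m \<sigma> :: "'g \<Rightarrow> nat"
  assumes "finite G" "v0 \<in> G" "0 < \<sigma> v0"
  shows "(\<Prod>v\<in>G. m v choose \<sigma> v) * \<sigma> v0 =
    m v0 * (\<Prod>v\<in>G. (m(v0 := m v0 - 1)) v choose (\<sigma>(v0 := \<sigma> v0 - 1)) v)"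
proof -
  have "(\<Prod>v\<in>G. m v choose \<sigma> v) = (m v0 choose \<sigma> v0) * (\<Prod>v\<in>G-{v0}. m v choose \<sigma> v)"
    using assms by (simp add: prod.remove)
  moreover have "(\<Prod>v\<in>G. (m(v0 := m v0 - 1)) v choose (\<sigma>(v0 := \<sigma> v0 - 1)) v) =
      (m v0 - 1 choose (\<sigma> v0 - 1)) * (\<Prod>v\<in>G-{v0}. m v choose \<sigma> v)"
    using assms by (subst prod.remove[of _ v0]) auto
  moreover have "\<sigma> v0 * (m v0 choose \<sigma> v0) = m v0 * (m v0 - 1 choose (\<sigma> v0 - 1))"
    using assms(3) by (rule times_binomial_minus1_eq)
  ultimately show ?thesis
    by (simp only: mult.assoc mult.commute mult.left_commute) (simp only: mult.assoc[symmetric])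
qed

lemma prod_choose_skip:
  fixes m \<sigma> :: "'g \<Rightarrow> nat"
  assumes "finite G" "v0 \<in> G"
  shows "(\<Prod>v\<in>G. m v choose \<sigma> v) * (m v0 - \<sigma> v0) =
    m v0 * (\<Prod>v\<in>G. (m(v0 := m v0 - 1)) v choose \<sigma> v)"
proof -
  have "(\<Prod>v\<in>G. m v choose \<sigma> v) = (m v0 choose \<sigma> v0) * (\<Prod>v\<in>G-{v0}. m v choose \<sigma> v)"
    using assms by (simp add: prod.remove)
  moreover have "(\<Prod>v\<in>G. (m(v0 := m v0 - 1)) v choose \<sigma> v) =
      (m v0 - 1 choose \<sigma> v0) * (\<Prod>v\<in>G-{v0}. m v choose \<sigma> v)"
    using assms by (subst prod.remove[of _ v0]) auto
  moreover have "(m v0 - \<sigma> v0) * (m v0 choose \<sigma> v0) = m v0 * (m v0 - 1 choose \<sigma> v0)"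
    by (rule binomial_absorb_comp)
  ultimately show ?thesis by (metis mult.assoc mult.commute)
qed

text \<open>\<open>L i j\<close> is the portion of block \<open>j\<close> of partition \<open>i\<close> built so far, \<open>\<rho> i j v\<close> the number of
  points of colour \<open>v\<close> it still needs, and \<open>m v\<close> the number of unplaced points of colour \<open>v\<close>.
  Placing the next point, of colour \<open>v0\<close>, in each block with weight \<open>\<rho> i j v0 / m v0\<close> keeps the
  bound on the multiplicities exactly; an integral rounding of these weights keeps it too, since
  the bounds are integers.\<close>

lemma baranyai_step:
  fixes \<rho> :: "'i \<Rightarrow> 'j \<Rightarrow> 'g \<Rightarrow> nat" and L :: "'i \<Rightarrow> 'j \<Rightarrow> 'a set" and m :: "'g \<Rightarrow> nat"
    and I :: "'i set" and J :: "'j set"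
  defines "C \<equiv> \<lambda>S \<sigma>. Sigma I (\<lambda>i. {j\<in>J. L i j = S \<and> \<rho> i j = \<sigma>})"
  assumes fin: "finite I" "finite J" "finite G" and v0: "v0 \<in> G" "0 < m v0"
    and total: "\<And>i. i \<in> I \<Longrightarrow> (\<Sum>j\<in>J. \<rho> i j v0) = m v0"
    and bound: "\<And>S \<sigma>. card (C S \<sigma>) \<le> (\<Prod>v\<in>G. m v choose \<sigma> v)"
  obtains s where "\<And>i. i \<in> I \<Longrightarrow> s i \<in> J \<and> 0 < \<rho> i (s i) v0"
    and "\<And>S \<sigma>. card {i\<in>I. L i (s i) = S \<and> \<rho> i (s i) = \<sigma>} \<le>
          (\<Prod>v\<in>G. (m(v0 := m v0 - 1)) v choose (\<sigma>(v0 := \<sigma> v0 - 1)) v)"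
    and "\<And>S \<sigma>. card (C S \<sigma>) \<le> card {i\<in>I. L i (s i) = S \<and> \<rho> i (s i) = \<sigma>} +
          (\<Prod>v\<in>G. (m(v0 := m v0 - 1)) v choose \<sigma> v)"
proof -
  define key where "key i j = (L i j, \<rho> i j)" for i j
  define K where "K = (\<lambda>(i, j). key i j) ` (I \<times> J)"
  have finK: "finite K" using fin by (simp add: K_def)
  define w where "w i l = (\<Sum>j | j \<in> J \<and> key i j = l. real (\<rho> i j v0) / real (m v0))" for i l
  define up where "up \<sigma> = (\<Prod>v\<in>G. (m(v0 := m v0 - 1)) v choose (\<sigma>(v0 := \<sigma> v0 - 1)) v)" for \<sigma>
  define rest where "rest \<sigma> = (\<Prod>v\<in>G. (m(v0 := m v0 - 1)) v choose \<sigma> v)" for \<sigma>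
  have mass: "(\<Sum>i\<in>I. w i (S, \<sigma>)) = real (card (C S \<sigma>)) * \<sigma> v0 / m v0" for S \<sigma>
  proof -
    have "w i (S, \<sigma>) = real (card {j\<in>J. L i j = S \<and> \<rho> i j = \<sigma>}) * (\<sigma> v0 / m v0)" for i
      by (simp add: w_def key_def)
    moreover have "card (C S \<sigma>) = (\<Sum>i\<in>I. card {j\<in>J. L i j = S \<and> \<rho> i j = \<sigma>})"
      using fin by (simp add: C_def)
    ultimately show ?thesis by (simp add: sum_distrib_right sum_divide_distrib)
  qed
  have w1: "(\<Sum>l\<in>K. w i l) = 1" if i: "i \<in> I" for i
  proof -
    have "(\<Sum>l\<in>K. w i l) = (\<Sum>j\<in>J. real (\<rho> i j v0) / real (m v0))"
      unfolding w_def using i by (intro sum.group fin finK) (auto simp: K_def)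
    also have "\<dots> = real (\<Sum>j\<in>J. \<rho> i j v0) / real (m v0)"
      by (simp add: sum_divide_distrib)
    finally show ?thesis using total[OF i] v0 by simp
  qed
  have upper: "(\<Sum>i\<in>I. w i l) \<le> real (case l of (S, \<sigma>) \<Rightarrow> up \<sigma>)" for l
  proof (cases l)
    case (Pair S \<sigma>)
    show ?thesis
    proof (cases "\<sigma> v0 = 0")
      case False
      have "card (C S \<sigma>) * \<sigma> v0 \<le> (\<Prod>v\<in>G. m v choose \<sigma> v) * \<sigma> v0"
        using bound by simp
      also have "\<dots> = m v0 * up \<sigma>"
        unfolding up_def using False v0 fin by (intro prod_choose_take) auto
      finally have "real (card (C S \<sigma>)) * \<sigma> v0 \<le> real (m v0) * up \<sigma>"
        by (metis of_nat_le_iff of_nat_mult)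
      then show ?thesis using v0 Pair by (simp add: mass field_simps)
    qed (simp add: Pair mass)
  qed
  have lower: "real (case l of (S, \<sigma>) \<Rightarrow> card (C S \<sigma>) - rest \<sigma>) \<le> (\<Sum>i\<in>I. w i l)" for l
  proof (cases l)
    case (Pair S \<sigma>)
    let ?c = "card (C S \<sigma>)"
    have "?c * (m v0 - \<sigma> v0) \<le> (\<Prod>v\<in>G. m v choose \<sigma> v) * (m v0 - \<sigma> v0)"
      using bound by simp
    also have "\<dots> = m v0 * rest \<sigma>"
      unfolding rest_def using v0 fin by (intro prod_choose_skip)
    finally have "real ?c * real (m v0 - \<sigma> v0) \<le> real (m v0) * rest \<sigma>"
      by (metis of_nat_le_iff of_nat_mult)
    moreover have "real ?c * (real (m v0) - \<sigma> v0) \<le> real ?c * real (m v0 - \<sigma> v0)"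
      by (intro mult_left_mono) auto
    ultimately have "real ?c * m v0 - real (m v0) * rest \<sigma> \<le> real ?c * \<sigma> v0"
      by (simp add: right_diff_distrib)
    then have "real ?c - rest \<sigma> \<le> real ?c * \<sigma> v0 / m v0"
      using v0 by (simp add: field_simps)
    moreover have "0 \<le> real ?c * \<sigma> v0 / m v0" by simp
    ultimately have "real (?c - rest \<sigma>) \<le> real ?c * \<sigma> v0 / m v0" by linarith
    then show ?thesis by (simp add: Pair mass)
  qed
  obtain h where h: "\<And>i. i \<in> I \<Longrightarrow> h i \<in> K \<and> 0 < w i (h i)"
    and hb: "\<And>l. l \<in> K \<Longrightarrow> (case l of (S, \<sigma>) \<Rightarrow> card (C S \<sigma>) - rest \<sigma>) \<le> card {i\<in>I. h i = l} \<and>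
       card {i\<in>I. h i = l} \<le> (case l of (S, \<sigma>) \<Rightarrow> up \<sigma>)"
    by (rule integral_rounding[OF fin(1) finK _ w1 lower upper])
      (auto simp: w_def sum_nonneg)
  have "\<exists>j. j \<in> J \<and> 0 < \<rho> i j v0 \<and> key i j = h i" if i: "i \<in> I" for i
  proof (rule ccontr)
    assume "\<not> ?thesis"
    then have "w i (h i) = 0" unfolding w_def by (intro sum.neutral) auto
    with h[OF i] show False by simp
  qed
  then obtain s where s: "\<And>i. i \<in> I \<Longrightarrow> s i \<in> J \<and> 0 < \<rho> i (s i) v0 \<and> key i (s i) = h i"
    by metis
  have fib: "{i\<in>I. L i (s i) = S \<and> \<rho> i (s i) = \<sigma>} = {i\<in>I. h i = (S, \<sigma>)}" for S \<sigma>
    using s by (auto simp: key_def) (metis prod.inject)+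
  have outside: "{i\<in>I. h i = (S, \<sigma>)} = {}" "C S \<sigma> = {}" if "(S, \<sigma>) \<notin> K" for S \<sigma>
  proof -
    show "{i\<in>I. h i = (S, \<sigma>)} = {}" using that h by force
    show "C S \<sigma> = {}" using that by (force simp: C_def K_def key_def)
  qed
  show thesis
  proof (rule that[of s])
    show "s i \<in> J \<and> 0 < \<rho> i (s i) v0" if "i \<in> I" for i using s that by blast
    fix S \<sigma>
    show "card {i\<in>I. L i (s i) = S \<and> \<rho> i (s i) = \<sigma>} \<le>
          (\<Prod>v\<in>G. (m(v0 := m v0 - 1)) v choose (\<sigma>(v0 := \<sigma> v0 - 1)) v)"
      unfolding fib using hb[of "(S, \<sigma>)"]
      by (cases "(S, \<sigma>) \<in> K") (auto simp: up_def outside)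
    show "card (C S \<sigma>) \<le> card {i\<in>I. L i (s i) = S \<and> \<rho> i (s i) = \<sigma>} +
          (\<Prod>v\<in>G. (m(v0 := m v0 - 1)) v choose \<sigma> v)"
      unfolding fib using hb[of "(S, \<sigma>)"]
      by (cases "(S, \<sigma>) \<in> K") (auto simp: rest_def outside)
  qed
qed

lemma baranyai_extension:
  fixes \<rho> :: "'i \<Rightarrow> 'j \<Rightarrow> 'g \<Rightarrow> nat" and L :: "'i \<Rightarrow> 'j \<Rightarrow> 'a set" and g :: "'a \<Rightarrow> 'g"
  assumes fin: "finite I" "finite J" "finite G" and X: "finite X" "g ` X \<subseteq> G"
    and total: "\<And>i v. i \<in> I \<Longrightarrow> v \<in> G \<Longrightarrow> (\<Sum>j\<in>J. \<rho> i j v) = card {x\<in>X. g x = v}"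
    and bound: "\<And>S \<sigma>. card (Sigma I (\<lambda>i. {j\<in>J. L i j = S \<and> \<rho> i j = \<sigma>}))
                  \<le> (\<Prod>v\<in>G. card {x\<in>X. g x = v} choose \<sigma> v)"
    and disj: "\<And>i j. i \<in> I \<Longrightarrow> j \<in> J \<Longrightarrow> L i j \<inter> X = {}"
  shows "\<exists>f. (\<forall>i\<in>I. f i ` X \<subseteq> J) \<and>
    (\<forall>i\<in>I. \<forall>j\<in>J. \<forall>v\<in>G. card {x\<in>X. g x = v \<and> f i x = j} = \<rho> i j v) \<and>
    (\<forall>i\<in>I. \<forall>j\<in>J. \<forall>i'\<in>I. \<forall>j'\<in>J. L i j = L i' j' \<longrightarrow> \<rho> i j = \<rho> i' j' \<longrightarrow>
       {x\<in>X. f i x = j} = {x\<in>X. f i' x = j'} \<longrightarrow> i = i' \<and> j = j')"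
  using X total bound disj
proof (induction X arbitrary: L \<rho> rule: finite_induct)
  case empty
  have "i = i' \<and> j = j'" if "i \<in> I" "j \<in> J" "i' \<in> I" "j' \<in> J" "L i j = L i' j'" "\<rho> i j = \<rho> i' j'"
    for i j i' j'
  proof -
    let ?C = "Sigma I (\<lambda>k. {l\<in>J. L k l = L i j \<and> \<rho> k l = \<rho> i j})"
    have "(\<Prod>v\<in>G. (0::nat) choose \<rho> i j v) \<le> (\<Prod>v\<in>G. 1)"
    proof (intro prod_mono conjI)
      show "(0 choose \<rho> i j v) \<le> 1" for v by (cases "\<rho> i j v") auto
    qed simp
    then have "card ?C \<le> Suc 0" using empty.prems(3)[of "L i j" "\<rho> i j"] by simp
    moreover have "finite ?C" using fin by auto
    ultimately have "\<forall>p\<in>?C. \<forall>q\<in>?C. p = q" by (rule iffD1[OF card_le_Suc0_iff_eq, rotated])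
    moreover have "(i, j) \<in> ?C" "(i', j') \<in> ?C" using that by auto
    ultimately have "(i, j) = (i', j')" by blast
    then show ?thesis by simp
  qed
  moreover have "\<rho> i j v = 0" if "i \<in> I" "j \<in> J" "v \<in> G" for i j v
    using empty.prems(2)[of i v] that fin by simp
  ultimately show ?case by auto
next
  case (insert x X)
  define v0 where "v0 = g x"
  define m where "m v = card {y\<in>insert x X. g y = v}" for v
  define m' where "m' = m(v0 := m v0 - 1)"
  have v0: "v0 \<in> G" using insert.prems by (simp add: v0_def)
  have "{y\<in>insert x X. g y = v0} = insert x {y\<in>X. g y = v0}" by (auto simp: v0_def)
  then have mv0: "m v0 = Suc (card {y\<in>X. g y = v0})"
    using insert.hyps by (simp add: m_def)
  have "{y\<in>insert x X. g y = v} = {y\<in>X. g y = v}" if "v \<noteq> v0" for v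
    using that by (auto simp: v0_def)
  then have m': "card {y\<in>X. g y = v} = m' v" for v
    using mv0 by (simp add: m'_def m_def)
  obtain s where s: "\<And>i. i \<in> I \<Longrightarrow> s i \<in> J \<and> 0 < \<rho> i (s i) v0"
    and s_up: "\<And>S \<sigma>. card {i\<in>I. L i (s i) = S \<and> \<rho> i (s i) = \<sigma>} \<le>
          (\<Prod>v\<in>G. m' v choose (\<sigma>(v0 := \<sigma> v0 - 1)) v)"
    and s_low: "\<And>S \<sigma>. card (Sigma I (\<lambda>i. {j\<in>J. L i j = S \<and> \<rho> i j = \<sigma>})) \<le>
          card {i\<in>I. L i (s i) = S \<and> \<rho> i (s i) = \<sigma>} + (\<Prod>v\<in>G. m' v choose \<sigma> v)"
    using baranyai_step[OF fin v0, of m \<rho> L] insert.prems(2)[OF _ v0] insert.prems(3) mv0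
    unfolding m_def[symmetric] m'_def by auto
  define L' where "L' i j = (if j = s i then insert x (L i j) else L i j)" for i j
  define \<rho>' where "\<rho>' i j = (if j = s i then (\<rho> i j)(v0 := \<rho> i j v0 - 1) else \<rho> i j)" for i j
  have xL: "x \<notin> L i j" if "i \<in> I" "j \<in> J" for i j
    using insert.prems(4)[OF that] by auto
  have total': "(\<Sum>j\<in>J. \<rho>' i j v) = card {y\<in>X. g y = v}" if i: "i \<in> I" and v: "v \<in> G" for i v
  proof -
    have "(\<Sum>j\<in>J. \<rho> i j v) = \<rho> i (s i) v + (\<Sum>j\<in>J-{s i}. \<rho> i j v)"
      using s[OF i] fin by (intro sum.remove) auto
    moreover have "(\<Sum>j\<in>J. \<rho>' i j v) = \<rho>' i (s i) v + (\<Sum>j\<in>J-{s i}. \<rho> i j v)"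
      using s[OF i] fin by (subst sum.remove[of _ "s i"]) (auto simp: \<rho>'_def)
    moreover have "(\<Sum>j\<in>J. \<rho> i j v) = m v" using insert.prems(2)[OF i v] by (simp add: m_def)
    ultimately show ?thesis using s[OF i] unfolding m' m'_def
      by (auto simp: \<rho>'_def)
  qed
  have bound': "card (Sigma I (\<lambda>i. {j\<in>J. L' i j = S \<and> \<rho>' i j = \<sigma>}))
                  \<le> (\<Prod>v\<in>G. card {y\<in>X. g y = v} choose \<sigma> v)" for S \<sigma>
  proof (cases "x \<in> S")
    case True
    let ?\<sigma> = "\<sigma>(v0 := \<sigma> v0 + 1)"
    have "Sigma I (\<lambda>i. {j\<in>J. L' i j = S \<and> \<rho>' i j = \<sigma>}) \<subseteq>
        (\<lambda>i. (i, s i)) ` {i\<in>I. L i (s i) = S - {x} \<and> \<rho> i (s i) = ?\<sigma>}"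
    proof
      fix p assume "p \<in> Sigma I (\<lambda>i. {j\<in>J. L' i j = S \<and> \<rho>' i j = \<sigma>})"
      then obtain i j where p: "p = (i, j)" "i \<in> I" "j \<in> J" "L' i j = S" "\<rho>' i j = \<sigma>" by auto
      have j: "j = s i" using p xL[of i j] True by (auto simp: L'_def split: if_splits)
      have "L i (s i) = S - {x}" using p j xL[of i j] by (auto simp: L'_def)
      moreover have "\<rho> i (s i) = ?\<sigma>" using p j s[of i] by (auto simp: \<rho>'_def)
      ultimately show "p \<in> (\<lambda>i. (i, s i)) ` {i\<in>I. L i (s i) = S - {x} \<and> \<rho> i (s i) = ?\<sigma>}"
        using p j by auto
    qed
    then have "card (Sigma I (\<lambda>i. {j\<in>J. L' i j = S \<and> \<rho>' i j = \<sigma>})) \<le>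
        card {i\<in>I. L i (s i) = S - {x} \<and> \<rho> i (s i) = ?\<sigma>}"
      using fin by (intro surj_card_le) auto
    also have "\<dots> \<le> (\<Prod>v\<in>G. m' v choose \<sigma> v)"
      using s_up[of "S - {x}" ?\<sigma>] by simp
    finally show ?thesis by (simp add: m')
  next
    case False
    let ?A = "Sigma I (\<lambda>i. {j\<in>J. L' i j = S \<and> \<rho>' i j = \<sigma>})"
    let ?B = "(\<lambda>i. (i, s i)) ` {i\<in>I. L i (s i) = S \<and> \<rho> i (s i) = \<sigma>}"
    have sub: "?A \<union> ?B \<subseteq> Sigma I (\<lambda>i. {j\<in>J. L i j = S \<and> \<rho> i j = \<sigma>})"
      using False s by (auto simp: L'_def \<rho>'_def split: if_splits)
    have disj: "?A \<inter> ?B = {}" using False by (auto simp: L'_def)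
    have "card ?A + card ?B = card (?A \<union> ?B)"
      using fin disj by (intro card_Un_disjoint[symmetric]) auto
    also have "\<dots> \<le> card (Sigma I (\<lambda>i. {j\<in>J. L i j = S \<and> \<rho> i j = \<sigma>}))"
      using sub fin by (intro card_mono) auto
    also have "\<dots> \<le> card {i\<in>I. L i (s i) = S \<and> \<rho> i (s i) = \<sigma>} + (\<Prod>v\<in>G. m' v choose \<sigma> v)"
      by (rule s_low)
    also have "card {i\<in>I. L i (s i) = S \<and> \<rho> i (s i) = \<sigma>} = card ?B"
      by (rule card_image[symmetric]) (auto simp: inj_on_def)
    finally show ?thesis by (simp add: m')
  qed
  have disj': "L' i j \<inter> X = {}" if "i \<in> I" "j \<in> J" for i j
    using insert.prems(4)[OF that] insert.hyps by (auto simp: L'_def)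
  obtain f where f: "\<forall>i\<in>I. f i ` X \<subseteq> J"
    "\<forall>i\<in>I. \<forall>j\<in>J. \<forall>v\<in>G. card {y\<in>X. g y = v \<and> f i y = j} = \<rho>' i j v"
    "\<forall>i\<in>I. \<forall>j\<in>J. \<forall>i'\<in>I. \<forall>j'\<in>J. L' i j = L' i' j' \<longrightarrow> \<rho>' i j = \<rho>' i' j' \<longrightarrow>
       {y\<in>X. f i y = j} = {y\<in>X. f i' y = j'} \<longrightarrow> i = i' \<and> j = j'"
    using insert.IH[OF _ total' bound' disj'] insert.prems(1) by auto
  define f' where "f' i = (f i)(x := s i)" for i
  have blk: "{y\<in>insert x X. P y \<and> f' i y = j} =
      (if j = s i \<and> P x then insert x {y\<in>X. P y \<and> f i y = j} else {y\<in>X. P y \<and> f i y = j})" for P i j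
    using insert.hyps by (auto simp: f'_def)
  have "\<forall>i\<in>I. f' i ` insert x X \<subseteq> J"
    using f(1) s insert.hyps by (auto simp: f'_def)
  moreover have "\<forall>i\<in>I. \<forall>j\<in>J. \<forall>v\<in>G. card {y\<in>insert x X. g y = v \<and> f' i y = j} = \<rho> i j v"
  proof (intro ballI)
    fix i j v assume "i \<in> I" "j \<in> J" "v \<in> G"
    then show "card {y\<in>insert x X. g y = v \<and> f' i y = j} = \<rho> i j v"
      unfolding blk using f(2) s[of i] insert.hyps by (auto simp: \<rho>'_def v0_def)
  qed
  moreover have "\<forall>i\<in>I. \<forall>j\<in>J. \<forall>i'\<in>I. \<forall>j'\<in>J. L i j = L i' j' \<longrightarrow> \<rho> i j = \<rho> i' j' \<longrightarrow>
      {y\<in>insert x X. f' i y = j} = {y\<in>insert x X. f' i' y = j'} \<longrightarrow> i = i' \<and> j = j'"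
  proof (intro ballI impI)
    fix i j i' j' assume ij: "i \<in> I" "j \<in> J" "i' \<in> I" "j' \<in> J" and
      eq: "L i j = L i' j'" "\<rho> i j = \<rho> i' j'" "{y\<in>insert x X. f' i y = j} = {y\<in>insert x X. f' i' y = j'}"
    have "x \<in> {y\<in>insert x X. f' i y = j} \<longleftrightarrow> x \<in> {y\<in>insert x X. f' i' y = j'}"
      using eq(3) by simp
    then have sel: "j = s i \<longleftrightarrow> j' = s i'" by (auto simp: f'_def)
    then have "L' i j = L' i' j'" "\<rho>' i j = \<rho>' i' j'" using eq by (auto simp: L'_def \<rho>'_def)
    moreover have "{y\<in>X. f i y = j} = {y\<in>insert x X. f' i y = j} - {x}" for i j
      using insert.hyps by (auto simp: f'_def)
    then have "{y\<in>X. f i y = j} = {y\<in>X. f i' y = j'}" using eq(3) by simp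
    ultimately show "i = i' \<and> j = j'" using f(3) ij by meson
  qed
  ultimately show ?case by (intro exI[of _ f'] conjI)
qed

theorem baranyai_coloured:
  fixes \<tau> :: "'j \<Rightarrow> 'g \<Rightarrow> nat" and g :: "'a \<Rightarrow> 'g"
  assumes fin: "finite J" "finite G" "finite X" "g ` X \<subseteq> G"
    and total: "\<And>v. v \<in> G \<Longrightarrow> (\<Sum>j\<in>J. \<tau> j v) = card {x\<in>X. g x = v}"
    and bound: "\<And>l. l \<in> J \<Longrightarrow> M * card {j\<in>J. \<tau> j = \<tau> l}
                  \<le> (\<Prod>v\<in>G. card {x\<in>X. g x = v} choose \<tau> l v)"
    and supp: "\<And>j v. j \<in> J \<Longrightarrow> v \<notin> G \<Longrightarrow> \<tau> j v = 0"
  obtains f :: "nat \<Rightarrow> 'a \<Rightarrow> 'j" where "\<And>i x. i < M \<Longrightarrow> x \<in> X \<Longrightarrow> f i x \<in> J"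
    and "\<And>i j v. i < M \<Longrightarrow> j \<in> J \<Longrightarrow> v \<in> G \<Longrightarrow> card {x\<in>X. g x = v \<and> f i x = j} = \<tau> j v"
    and "\<And>i j i' j'. i < M \<Longrightarrow> j \<in> J \<Longrightarrow> i' < M \<Longrightarrow> j' \<in> J \<Longrightarrow>
       {x\<in>X. f i x = j} = {x\<in>X. f i' x = j'} \<Longrightarrow> i = i' \<and> j = j'"
proof -
  have bound': "card (SIGMA i:{..<M}. {j\<in>J. {} = S \<and> \<tau> j = \<sigma>}) \<le>
      (\<Prod>v\<in>G. card {x\<in>X. g x = v} choose \<sigma> v)" for S :: "'a set" and \<sigma>
  proof (cases "S = {} \<and> \<sigma> \<in> \<tau> ` J")
    case True
    then obtain l where l: "l \<in> J" "\<sigma> = \<tau> l" "S = {}" by auto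
    then show ?thesis using bound[OF l(1)] fin by simp
  next
    case False
    then have "(SIGMA i:{..<M}. {j\<in>J. {} = S \<and> \<tau> j = \<sigma>}) = {}" by auto
    then show ?thesis by (metis card.empty zero_le)
  qed
  have "\<exists>f. (\<forall>i\<in>{..<M}. f i ` X \<subseteq> J) \<and>
    (\<forall>i\<in>{..<M}. \<forall>j\<in>J. \<forall>v\<in>G. card {x\<in>X. g x = v \<and> f i x = j} = \<tau> j v) \<and>
    (\<forall>i\<in>{..<M}. \<forall>j\<in>J. \<forall>i'\<in>{..<M}. \<forall>j'\<in>J. ({}::'a set) = {} \<longrightarrow> \<tau> j = \<tau> j' \<longrightarrow>
       {x\<in>X. f i x = j} = {x\<in>X. f i' x = j'} \<longrightarrow> i = i' \<and> j = j')"
    by (rule baranyai_extension[where \<rho>="\<lambda>i. \<tau>" and L="\<lambda>i j. {}"])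
      (use fin total bound' in auto)
  then obtain f :: "nat \<Rightarrow> 'a \<Rightarrow> 'j" where f: "\<forall>i\<in>{..<M}. f i ` X \<subseteq> J"
    "\<forall>i\<in>{..<M}. \<forall>j\<in>J. \<forall>v\<in>G. card {x\<in>X. g x = v \<and> f i x = j} = \<tau> j v"
    "\<forall>i\<in>{..<M}. \<forall>j\<in>J. \<forall>i'\<in>{..<M}. \<forall>j'\<in>J. \<tau> j = \<tau> j' \<longrightarrow>
       {x\<in>X. f i x = j} = {x\<in>X. f i' x = j'} \<longrightarrow> i = i' \<and> j = j'"
    by (elim exE conjE) (rule that, simp_all)
  have same: "\<tau> j = \<tau> j'" if "i < M" "j \<in> J" "i' < M" "j' \<in> J"
    "{x\<in>X. f i x = j} = {x\<in>X. f i' x = j'}" for i j i' j'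
  proof
    fix v
    have "{x\<in>X. g x = v \<and> f i x = j} = {x\<in>X. f i x = j} \<inter> {x. g x = v}" for i j by auto
    then have "{x\<in>X. g x = v \<and> f i x = j} = {x\<in>X. g x = v \<and> f i' x = j'}" using that by simp
    moreover have "card {x\<in>X. g x = v \<and> f i x = j} = \<tau> j v"
      "card {x\<in>X. g x = v \<and> f i' x = j'} = \<tau> j' v" if "v \<in> G"
      using f(2) that \<open>i < M\<close> \<open>j \<in> J\<close> \<open>i' < M\<close> \<open>j' \<in> J\<close> by auto
    ultimately show "\<tau> j v = \<tau> j' v"
      using supp[of j v] supp[of j' v] that by (cases "v \<in> G") simp_all
  qed
  show thesis
  proof (rule that[of f])
    show "i = i' \<and> j = j'" if "i < M" "j \<in> J" "i' < M" "j' \<in> J"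
      "{x\<in>X. f i x = j} = {x\<in>X. f i' x = j'}" for i j i' j'
      using f(3) same[OF that] that by blast
  qed (use f(1,2) in auto)
qed

subsection \<open>Sperner partition systems from colourings\<close>

lemma card_residue_class:
  fixes m Q a :: nat
  assumes "a < Q"
  shows "m div Q \<le> card {j. j < m \<and> j mod Q = a}"
    and "card {j. j < m \<and> j mod Q = a} \<le> m div Q + 1"
proof -
  have inj: "inj_on (\<lambda>i. a + i * Q) A" for A
    using assms by (auto simp: inj_on_def)
  have "(\<lambda>i. a + i * Q) ` {..<m div Q} \<subseteq> {j. j < m \<and> j mod Q = a}"
  proof clarify
    fix i assume "i < m div Q"
    then have "(i + 1) * Q \<le> m div Q * Q" by (intro mult_right_mono) auto
    also have "\<dots> \<le> m" by simp
    finally show "a + i * Q < m \<and> (a + i * Q) mod Q = a" using assms by simp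
  qed
  from card_mono[OF _ this] show "m div Q \<le> card {j. j < m \<and> j mod Q = a}"
    by (simp add: card_image inj)
  have "{j. j < m \<and> j mod Q = a} \<subseteq> (\<lambda>i. a + i * Q) ` {..m div Q}"
  proof
    fix j assume "j \<in> {j. j < m \<and> j mod Q = a}"
    then have "j = a + (j div Q) * Q" "j div Q \<le> m div Q"
      by (auto simp: div_le_mono)
    then show "j \<in> (\<lambda>i. a + i * Q) ` {..m div Q}" by blast
  qed
  from card_mono[OF _ this] show "card {j. j < m \<and> j mod Q = a} \<le> m div Q + 1"
    by (simp add: card_image inj)
qed

lemma real_div_gt:
  assumes "0 < (b::nat)"
  shows "real a / real b - 1 \<le> real (a div b)"
proof -
  have "a = a div b * b + a mod b" by simp
  then have "real a = real (a div b) * b + real (a mod b)"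
    by (metis of_nat_add of_nat_mult)
  moreover have "real (a mod b) \<le> b" using assms by simp
  ultimately show ?thesis using assms by (simp add: field_simps)
qed

lemma card_subsets_containing:
  assumes "v < t" "0 < c"
  shows "card {A. A \<subseteq> {..<t} \<and> card A = c \<and> v \<in> A} = (t - 1) choose (c - 1)"
proof -
  let ?B = "{A. A \<subseteq> {..<t} \<and> card A = c \<and> v \<in> A}"
  let ?C = "{A. A \<subseteq> {..<t} - {v} \<and> card A = c}"
  have fin: "finite ?B" "finite ?C"
    by (rule finite_subset[of _ "Pow {..<t}"]; auto)+
  have "{A. A \<subseteq> {..<t} \<and> card A = c} = ?B \<union> ?C" by auto
  then have "card ?B + card ?C = t choose c"
    using n_subsets[of "{..<t}" c] fin by (subst card_Un_disjoint[symmetric]) auto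
  moreover have "card ?C = t - 1 choose c"
    using n_subsets[of "{..<t} - {v}" c] assms by simp
  moreover have "t choose c = (t - 1 choose (c - 1)) + (t - 1 choose c)"
    using assms by (cases t; cases c) auto
  ultimately show ?thesis by simp
qed

lemma ex_sperner_partition_system:
  fixes n k c r t M :: nat and s :: real
  assumes n: "n = c * k + r" "r < k" and c: "2 \<le> c" "c \<le> t"
    and s: "real c + 1 \<le> s" "s \<le> real n / t - real ((t - 1) choose (c - 1)) - (c + 1)"
    and M1: "real M * ((real k - real r) / real (t choose c) + 1) \<le> s ^ c"
    and M2: "real M * real k \<le> (s / (c + 1)) ^ (c + 1)"
  shows "\<exists>(X :: (nat \<times> nat) set) P. finite X \<and> card X = n \<and> card P = M \<and>
    sperner_partition_system k X P"
proof -
  define d where "d = k - r"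
  define Q where "Q = t choose c"
  have Q: "0 < Q" using c by (simp add: Q_def)
  have t: "0 < t" using c by simp
  have k: "k = d + r" using n by (simp add: d_def)
  obtain T where T: "bij_betw T {..<Q} {A. A \<subseteq> {..<t} \<and> card A = c}"
  proof -
    have "finite {A. A \<subseteq> {..<t} \<and> card A = c}"
      by (rule finite_subset[of _ "Pow {..<t}"]) auto
    then show thesis
      using that finite_same_card_bij[of "{..<Q}" "{A. A \<subseteq> {..<t} \<and> card A = c}"] n_subsets[of "{..<t}" c]
      by (auto simp: Q_def)
  qed
  \<comment> \<open>Every partition gets the same types: blocks \<open>j < d\<close> have size \<open>c\<close> and meet exactly the colours in
    \<open>S j\<close>, once each; the other blocks are monochromatic of size \<open>c + 1\<close>. The colour classes are
    then given the sizes \<open>N v\<close> that these types add up to.\<close>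
  define S where "S j = T (j mod Q)" for j
  have S: "S j \<subseteq> {..<t}" "card (S j) = c" for j
    using T Q by (auto simp: S_def bij_betw_def)
  have finS: "finite (S j)" for j using S(1) finite_subset by blast
  define \<tau> :: "nat \<Rightarrow> nat \<Rightarrow> nat" where
    "\<tau> j v = (if j < d then of_bool (v \<in> S j) else if v = (j - d) mod t then c + 1 else 0)" for j v
  define N where "N v = (\<Sum>j<k. \<tau> j v)" for v
  define X where "X = (SIGMA v:{..<t}. {..<N v})"
  have finX: "finite X" by (simp add: X_def)
  have cardX: "card {x\<in>X. fst x = v} = N v" if "v < t" for v
  proof -
    have "{x\<in>X. fst x = v} = {v} \<times> {..<N v}" using that by (auto simp: X_def)
    then show ?thesis by simp
  qed
  have \<tau>_sum: "(\<Sum>v<t. \<tau> j v) = (if j < d then c else c + 1)" for j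
  proof (cases "j < d")
    case True
    have "(\<Sum>v<t. of_bool (v \<in> S j)) = (\<Sum>v\<in>S j. 1::nat)"
      using S(1)[of j] by (intro sum.mono_neutral_cong_right) auto
    then show ?thesis using True S(2) by (simp add: \<tau>_def)
  next
    case False
    then have "(\<Sum>v<t. \<tau> j v) = (\<Sum>v<t. if v = (j - d) mod t then c + 1 else 0)"
      by (simp add: \<tau>_def)
    also have "\<dots> = c + 1" using t by (subst sum.delta) auto
    finally show ?thesis using False by simp
  qed
  have sum_k: "(\<Sum>j<k. f j) = (\<Sum>j<d. f j) + (\<Sum>j<r. f (d + j))" for f :: "nat \<Rightarrow> nat"
    unfolding k by (induction r) auto
  have "card X = (\<Sum>v<t. N v)" by (simp add: X_def)
  also have "\<dots> = (\<Sum>j<k. \<Sum>v<t. \<tau> j v)" unfolding N_def by (rule sum.swap)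
  also have "\<dots> = d * c + r * (c + 1)" by (simp add: \<tau>_sum sum_k)
  also have "\<dots> = n" using n(1) by (simp add: k algebra_simps)
  finally have card_n: "card X = n" .
  have N_ge: "s \<le> real (N v)" if v: "v < t" for v
  proof -
    define q where "q = (t - 1) choose (c - 1)"
    have "(\<Sum>j<d. \<tau> j v) = card {j. j < d \<and> v \<in> S j}"
      by (simp add: \<tau>_def of_bool_def sum.If_cases Int_def)
    also have "{j. j < d \<and> v \<in> S j} = (\<Union>a\<in>{a. a < Q \<and> v \<in> T a}. {j. j < d \<and> j mod Q = a})"
      using Q by (auto simp: S_def)
    also have "card \<dots> = (\<Sum>a | a < Q \<and> v \<in> T a. card {j. j < d \<and> j mod Q = a})"
      by (rule card_UN_disjoint) auto
    also have "\<dots> \<ge> (\<Sum>a | a < Q \<and> v \<in> T a. d div Q)"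
      by (intro sum_mono card_residue_class) auto
    also have "(\<Sum>a | a < Q \<and> v \<in> T a. d div Q) = q * (d div Q)"
    proof -
      have "bij_betw T {a. a < Q \<and> v \<in> T a} {A. A \<subseteq> {..<t} \<and> card A = c \<and> v \<in> A}"
      proof (rule bij_betw_imageI)
        show "inj_on T {a. a < Q \<and> v \<in> T a}"
          using T by (auto simp: bij_betw_def intro: inj_on_subset)
        have "T ` {a. a < Q \<and> v \<in> T a} = {A \<in> T ` {..<Q}. v \<in> A}" by auto
        then show "T ` {a. a < Q \<and> v \<in> T a} = {A. A \<subseteq> {..<t} \<and> card A = c \<and> v \<in> A}"
          using T by (auto simp: bij_betw_def)
      qed
      then have "card {a. a < Q \<and> v \<in> T a} = q"
        unfolding q_def using card_subsets_containing[of v t c] v c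
        by (simp add: bij_betw_same_card)
      then show ?thesis by simp
    qed
    finally have 1: "q * (d div Q) \<le> (\<Sum>j<d. \<tau> j v)" .
    have "(\<Sum>j<r. \<tau> (d + j) v) = (c + 1) * card {j. j < r \<and> j mod t = v}"
    proof -
      have "{..<r} \<inter> {j. v = j mod t} = {j. j < r \<and> j mod t = v}" by auto
      then show ?thesis by (simp add: \<tau>_def sum.If_cases)
    qed
    moreover have "r div t \<le> card {j. j < r \<and> j mod t = v}"
      by (rule card_residue_class[OF v])
    ultimately have 2: "(c + 1) * (r div t) \<le> (\<Sum>j<r. \<tau> (d + j) v)"
      by (simp only: mult_le_mono2)
    have "q * (d div Q) + (c + 1) * (r div t) \<le> N v"
      unfolding N_def sum_k by (rule add_mono[OF 1 2])
    then have "real (q * (d div Q) + (c + 1) * (r div t)) \<le> real (N v)"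
      by (simp only: of_nat_le_iff)
    then have "real q * real (d div Q) + (real c + 1) * real (r div t) \<le> N v"
      by (simp add: algebra_simps)
    moreover have "real q * (real d / Q - 1) \<le> real q * real (d div Q)"
      using real_div_gt[OF Q] by (intro mult_left_mono) auto
    moreover have "(real c + 1) * (real r / t - 1) \<le> (real c + 1) * real (r div t)"
      using real_div_gt[OF t] by (intro mult_left_mono) auto
    moreover have "real q / Q = real c / t"
    proof -
      have "c * Q = t * q" unfolding Q_def q_def using c by (intro times_binomial_minus1_eq) simp
      then have "real (c * Q) = real (t * q)" by simp
      then have "real c * Q = real t * q" by simp
      then show ?thesis using t Q by (simp add: field_simps)
    qed
    then have "real q / Q * d = real c / t * d" by simp
    then have "real q * (real d / Q - 1) = real c * d / t - q"
      by (simp add: right_diff_distrib)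
    moreover have "real c * d / t + (real c + 1) * (real r / t) = real n / t"
      using n(1) t by (simp add: k field_simps)
    ultimately show ?thesis using s(2) by (simp add: q_def algebra_simps)
  qed
  have s0: "0 \<le> s" using s(1) by simp
  have type_eq: "d \<le> j" if "d \<le> l" "\<tau> j = \<tau> l" for j l
  proof (rule ccontr)
    assume "\<not> d \<le> j"
    then have "\<tau> j ((l - d) mod t) \<le> 1" by (simp add: \<tau>_def)
    moreover have "\<tau> l ((l - d) mod t) = c + 1" using that by (simp add: \<tau>_def)
    ultimately show False using that c by simp
  qed
  have bound: "M * card {j\<in>{..<k}. \<tau> j = \<tau> l}
      \<le> (\<Prod>v\<in>{..<t}. card {x\<in>X. fst x = v} choose \<tau> l v)" if l: "l \<in> {..<k}" for l
  proof (cases "l < d")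
    case True
    have "{j\<in>{..<k}. \<tau> j = \<tau> l} \<subseteq> {j. j < d \<and> j mod Q = l mod Q}"
    proof clarify
      fix j assume j: "j < k" "\<tau> j = \<tau> l"
      have jd: "j < d" using type_eq[of j l] j True by (metis not_less)
      have "v \<in> S j \<longleftrightarrow> v \<in> S l" for v
        using fun_cong[OF j(2), of v] jd True by (simp add: \<tau>_def of_bool_eq_iff)
      then have "T (j mod Q) = T (l mod Q)" by (auto simp: S_def)
      then show "j < d \<and> j mod Q = l mod Q"
        using T Q jd by (auto simp: bij_betw_def inj_on_def)
    qed
    from card_mono[OF _ this] have "card {j\<in>{..<k}. \<tau> j = \<tau> l} \<le> d div Q + 1"
      using card_residue_class(2)[of "l mod Q" Q d] Q by simp
    then have "real (card {j\<in>{..<k}. \<tau> j = \<tau> l}) \<le> real d / Q + 1"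
      using of_nat_div_le_of_nat[where 'a=real, of d Q] by linarith
    then have "real M * card {j\<in>{..<k}. \<tau> j = \<tau> l} \<le> real M * (real d / Q + 1)"
      by (intro mult_left_mono) auto
    also have "\<dots> \<le> s ^ c" using M1 n by (simp add: d_def Q_def of_nat_diff)
    also have "\<dots> = (\<Prod>v\<in>S l. s)" using S by simp
    also have "\<dots> \<le> (\<Prod>v\<in>S l. real (N v))"
      using N_ge s0 S by (intro prod_mono) auto
    also have "\<dots> = (\<Prod>v\<in>{..<t}. real (card {x\<in>X. fst x = v} choose \<tau> l v))"
      using S(1)[of l] True by (intro prod.mono_neutral_cong_left) (auto simp: cardX \<tau>_def)
    finally show ?thesis by (simp only: of_nat_le_iff of_nat_mult[symmetric] of_nat_prod[symmetric])
  next
    case False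
    define v0 where "v0 = (l - d) mod t"
    have v0: "v0 < t" using t by (simp add: v0_def)
    have cN: "c + 1 \<le> N v0" using N_ge[OF v0] s by simp
    have "card {j\<in>{..<k}. \<tau> j = \<tau> l} \<le> card {..<k}" by (intro card_mono) auto
    then have "real M * card {j\<in>{..<k}. \<tau> j = \<tau> l} \<le> real M * real k"
      by (intro mult_left_mono) auto
    also have "\<dots> \<le> (s / (c + 1)) ^ (c + 1)" by (rule M2)
    also have "\<dots> \<le> (real (N v0) / real (c + 1)) ^ (c + 1)"
      using N_ge[OF v0] s0 by (intro power_mono divide_right_mono) (auto simp: add.commute)
    also have "\<dots> \<le> real (N v0 choose (c + 1))"
      using cN by (rule binomial_ge_n_over_k_pow_k)
    also have "N v0 choose (c + 1) = (\<Prod>v\<in>{v0}. card {x\<in>X. fst x = v} choose \<tau> l v)"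
      using False v0 by (simp add: cardX \<tau>_def v0_def)
    also have "\<dots> = (\<Prod>v\<in>{..<t}. card {x\<in>X. fst x = v} choose \<tau> l v)"
      using v0 False by (intro prod.mono_neutral_left) (auto simp: \<tau>_def v0_def)
    finally show ?thesis by (simp only: of_nat_le_iff of_nat_mult[symmetric])
  qed
  obtain f :: "nat \<Rightarrow> nat \<times> nat \<Rightarrow> nat"
    where fJ: "\<And>i x. i < M \<Longrightarrow> x \<in> X \<Longrightarrow> f i x \<in> {..<k}"
    and f_card: "\<And>i j v. i < M \<Longrightarrow> j \<in> {..<k} \<Longrightarrow> v \<in> {..<t} \<Longrightarrow>
        card {x\<in>X. fst x = v \<and> f i x = j} = \<tau> j v"
    and f_inj: "\<And>i j i' j'. i < M \<Longrightarrow> j \<in> {..<k} \<Longrightarrow> i' < M \<Longrightarrow> j' \<in> {..<k} \<Longrightarrow>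
       {x\<in>X. f i x = j} = {x\<in>X. f i' x = j'} \<Longrightarrow> i = i' \<and> j = j'"
  proof (rule baranyai_coloured[of "{..<k}" "{..<t}" X fst \<tau> M])
    show "(\<Sum>j<k. \<tau> j v) = card {x \<in> X. fst x = v}" if "v \<in> {..<t}" for v
      using that by (simp add: cardX N_def)
    show "\<tau> j v = 0" if "j \<in> {..<k}" "v \<notin> {..<t}" for j v
      using that S(1)[of j] t by (auto simp: \<tau>_def)
  qed (use bound finX in \<open>auto simp: X_def\<close>)
  define B where "B i j = {x\<in>X. f i x = j}" for i j
  have cardB: "card (B i j) = (if j < d then c else c + 1)" if "i < M" "j < k" for i j
  proof -
    have "B i j = (\<Union>v<t. {x\<in>X. fst x = v \<and> f i x = j})" by (auto simp: B_def X_def)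
    then have "card (B i j) = (\<Sum>v<t. card {x\<in>X. fst x = v \<and> f i x = j})"
      using finX by (simp add: card_UN_disjoint disjoint_iff)
    also have "\<dots> = (\<Sum>v<t. \<tau> j v)" using f_card that by simp
    finally show ?thesis by (simp add: \<tau>_sum)
  qed
  have finB: "finite (B i j)" for i j using finX by (simp add: B_def)
  have B_inj: "i = i' \<and> j = j'" if "B i j = B i' j'" "i < M" "j < k" "i' < M" "j' < k" for i j i' j'
    using f_inj that by (auto simp: B_def)
  define \<pi> where "\<pi> i = B i ` {..<k}" for i
  have part: "partition_on X (\<pi> i)" "card (\<pi> i) = k" if i: "i < M" for i
  proof -
    show "card (\<pi> i) = k"
      unfolding \<pi>_def using B_inj i by (subst card_image) (auto simp: inj_on_def)
    show "partition_on X (\<pi> i)"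
    proof (rule partition_onI)
      show "\<Union>(\<pi> i) = X" using fJ[OF i] by (auto simp: \<pi>_def B_def)
      show "{} \<notin> \<pi> i"
      proof
        assume "{} \<in> \<pi> i"
        then obtain j where "j < k" "B i j = {}" by (auto simp: \<pi>_def)
        then show False using cardB[OF i, of j] c by (auto split: if_splits)
      qed
    qed (auto simp: \<pi>_def B_def disjnt_def)
  qed
  have antichain: "\<not> B i j \<subseteq> B i' j'" if i: "i < M" "i' < M" "i \<noteq> i'" and j: "j < k" "j' < k" for i i' j j'
  proof
    assume sub: "B i j \<subseteq> B i' j'"
    have "card (B i j) \<noteq> card (B i' j')"
      using card_subset_eq[OF finB sub] B_inj i j by blast
    moreover have "card (B i j) \<le> card (B i' j')" using sub finB by (rule card_mono[rotated])
    ultimately have jd: "j < d" "\<not> j' < d" using cardB i j by (auto split: if_splits)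
    have "S j \<subseteq> {(j' - d) mod t}"
    proof
      fix v assume v: "v \<in> S j"
      have "{x\<in>X. fst x = v \<and> f i x = j} \<subseteq> {x\<in>X. fst x = v \<and> f i' x = j'}"
        using sub by (auto simp: B_def)
      then have "card {x\<in>X. fst x = v \<and> f i x = j} \<le> card {x\<in>X. fst x = v \<and> f i' x = j'}"
        using finX by (intro card_mono) auto
      then have "\<tau> j v \<le> \<tau> j' v"
        using f_card i j v S(1)[of j] by (simp add: subset_iff)
      then show "v \<in> {(j' - d) mod t}" using v jd by (auto simp: \<tau>_def split: if_splits)
    qed
    then have "card (S j) \<le> card {(j' - d) mod t}" by (intro card_mono) auto
    then show False using S(2)[of j] c by simp
  qed
  have "sperner_partition_system k X (\<pi> ` {..<M})"
    unfolding sperner_partition_system_def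
  proof (intro conjI ballI impI)
    fix p p' A A' assume "p \<in> \<pi> ` {..<M}" "p' \<in> \<pi> ` {..<M}" "p \<noteq> p'" "A \<in> p" "A' \<in> p'"
    then obtain i i' where "i < M" "i' < M" "i \<noteq> i'" "A \<in> \<pi> i" "A' \<in> \<pi> i'" by auto
    then obtain j j' where "i < M" "i' < M" "i \<noteq> i'" "j < k" "j' < k" "A = B i j" "A' = B i' j'"
      unfolding \<pi>_def by blast
    then show "\<not> A \<subseteq> A'" using antichain by simp
  qed (use part in auto)
  moreover have "card (\<pi> ` {..<M}) = M"
  proof -
    have "inj_on \<pi> {..<M}"
    proof (rule inj_onI, rule ccontr)
      fix i i' assume i: "i \<in> {..<M}" "i' \<in> {..<M}" "\<pi> i = \<pi> i'" "i \<noteq> i'"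
      have "B i 0 \<in> \<pi> i" using n(2) by (auto simp: \<pi>_def)
      then have "B i 0 \<in> \<pi> i'" using i(3) by simp
      then obtain j where "j < k" "B i 0 = B i' j" by (auto simp: \<pi>_def)
      then show False using antichain[of i i' 0 j] i n(2) by auto
    qed
    then show ?thesis by (simp add: card_image)
  qed
  ultimately show ?thesis using finX card_n by blast
qed

subsection \<open>The upper bound\<close>

text \<open>Induction on the ground set, averaging over the point that is removed.\<close>

lemma lym_inequality:
  assumes "finite X" "F \<subseteq> Pow X" "\<And>A B. A \<in> F \<Longrightarrow> B \<in> F \<Longrightarrow> A \<subseteq> B \<Longrightarrow> A = B"
  shows "(\<Sum>A\<in>F. 1 / real (card X choose card A)) \<le> 1"
  using assms
proof (induction "card X" arbitrary: X F)
  case 0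
  then have "F \<subseteq> {{}}" by auto
  then consider "F = {}" | "F = {{}}" by blast
  then show ?case by cases auto
next
  case (Suc n)
  have finF: "finite F" using Suc.prems(1,2) by (meson finite_Pow_iff finite_subset)
  show ?case
  proof (cases "X \<in> F")
    case True
    then have "F = {X}" using Suc.prems(2,3) by blast
    then show ?thesis by simp
  next
    case False
    have avg: "(\<Sum>x\<in>X. if x \<in> A then 0 else 1 / real (n choose card A)) =
        Suc n / real (Suc n choose card A)" if A: "A \<in> F" for A
    proof -
      have AX: "A \<subseteq> X" using A Suc.prems(2) by blast
      have lt: "card A < Suc n"
        using psubset_card_mono[OF Suc.prems(1), of A] A AX False Suc.hyps(2) by auto
      have "(\<Sum>x\<in>X. if x \<in> A then 0 else 1 / real (n choose card A)) = (\<Sum>x\<in>X - A. 1 / real (n choose card A))"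
        using Suc.prems(1) by (intro sum.mono_neutral_cong_right) auto
      also have "\<dots> = real (Suc n - card A) / real (n choose card A)"
        using AX Suc.prems(1) Suc.hyps(2) by (simp add: card_Diff_subset finite_subset)
      also have "\<dots> = Suc n / real (Suc n choose card A)"
      proof -
        have "(Suc n - card A) * (Suc n choose card A) = Suc n * (n choose card A)"
          using binomial_absorb_comp[of "Suc n" "card A"] by simp
        then have "real (Suc n - card A) * real (Suc n choose card A) = real (Suc n) * real (n choose card A)"
          by (simp only: of_nat_mult[symmetric])
        moreover have "0 < Suc n choose card A" "0 < n choose card A"
          using lt by (auto intro: zero_less_binomial)
        ultimately show ?thesis by (simp only: divide_simps) (simp add: mult.commute)
      qed
      finally show ?thesis .
    qed
    have IH: "(\<Sum>A | A \<in> F \<and> x \<notin> A. 1 / real (n choose card A)) \<le> 1" if x: "x \<in> X" for x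
    proof -
      have "n = card (X - {x})" using x Suc.hyps(2) Suc.prems(1) by simp
      then show ?thesis
        using Suc.hyps(1)[of "X - {x}" "{A \<in> F. x \<notin> A}"] Suc.prems by auto
    qed
    have "Suc n * (\<Sum>A\<in>F. 1 / real (Suc n choose card A)) =
        (\<Sum>A\<in>F. \<Sum>x\<in>X. if x \<in> A then 0 else 1 / real (n choose card A))"
      by (simp add: avg sum_distrib_left)
    also have "\<dots> = (\<Sum>x\<in>X. \<Sum>A\<in>F. if x \<in> A then 0 else 1 / real (n choose card A))"
      by (rule sum.swap)
    also have "\<dots> = (\<Sum>x\<in>X. \<Sum>A | A \<in> F \<and> x \<notin> A. 1 / real (n choose card A))"
      using finF by (intro sum.cong refl sum.mono_neutral_cong_right) auto
    also have "\<dots> \<le> (\<Sum>x\<in>X. 1)" using IH by (intro sum_mono) auto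
    also have "\<dots> = Suc n" using Suc.hyps(2) by simp
    finally have "real (Suc n) * (\<Sum>A\<in>F. 1 / real (Suc n choose card A)) \<le> real (Suc n) * 1" by simp
    then have "(\<Sum>A\<in>F. 1 / real (Suc n choose card A)) \<le> 1"
      by (subst (asm) mult_le_cancel_left_pos) auto
    then show ?thesis using Suc.hyps(2) by simp
  qed
qed

lemma inverse_binomial_Suc:
  assumes "j < n"
  shows "1 / real (n choose Suc j) = (1 / real (n choose j)) * ((real j + 1) / (real n - real j))"
proof -
  obtain m where m: "n = Suc m" using assms by (cases n) auto
  have "Suc j * (n choose Suc j) = (n - j) * (n choose j)"
    using Suc_times_binomial[of j m] binomial_absorb_comp[of n j] by (simp add: m)
  then have "real (Suc j) * real (n choose Suc j) = real (n - j) * real (n choose j)"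
    by (simp only: of_nat_mult[symmetric])
  moreover have "0 < n choose Suc j" "0 < n choose j" using assms by (auto intro: zero_less_binomial)
  ultimately show ?thesis using assms by (simp add: field_simps of_nat_diff)
qed

lemma inverse_binomial_convex:
  assumes "Suc j < n"
  shows "1 / real (n choose Suc j) - 1 / real (n choose j)
    \<le> 1 / real (n choose Suc (Suc j)) - 1 / real (n choose Suc j)"
proof -
  define f where "f = 1 / real (n choose Suc j)"
  have f0: "0 < f" using assms by (simp add: f_def)
  have "f = 1 / real (n choose j) * ((real j + 1) / (real n - real j))"
    unfolding f_def using assms by (intro inverse_binomial_Suc) auto
  then have 1: "1 / real (n choose j) = f * ((real n - j) / (real j + 1))"
    using assms by (simp add: field_simps)
  have 2: "1 / real (n choose Suc (Suc j)) = f * ((real j + 2) / (real n - j - 1))"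
    unfolding f_def using inverse_binomial_Suc[OF assms] by (simp add: algebra_simps)
  have "2 \<le> (real n - j) / (real j + 1) + (real j + 2) / (real n - j - 1)"
  proof -
    define a b where "a = real n - j" and "b = real j + 1"
    have ab: "1 < a" "0 < b" using assms by (auto simp: a_def b_def)
    have "a / b + (b + 1) / (a - 1) - 2 = ((a - b) * (a - b - 1) + 2 * b) / (b * (a - 1))"
      using ab by (simp add: field_simps)
    moreover have "0 \<le> (a - b) * (a - b - 1) + 2 * b"
    proof -
      have "0 \<le> (a - b - 1 / 2) * (a - b - 1 / 2)" by simp
      moreover have "1 \<le> b" by (simp add: b_def)
      ultimately show ?thesis by (simp add: algebra_simps)
    qed
    ultimately have "0 \<le> a / b + (b + 1) / (a - 1) - 2" using ab by simp
    then show ?thesis by (simp add: a_def b_def algebra_simps)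
  qed
  then have "2 * f \<le> f * ((real n - j) / (real j + 1) + (real j + 2) / (real n - j - 1))"
    using f0 by simp
  then show ?thesis using 1 2 by (simp add: f_def distrib_left)
qed

lemma inverse_binomial_tangent:
  assumes "c < n" "j \<le> n"
  shows "1 / real (n choose c) + (real j - real c) * (1 / real (n choose Suc c) - 1 / real (n choose c))
    \<le> 1 / real (n choose j)"
proof -
  define f where "f i = 1 / real (n choose i)" for i
  have mono: "f (Suc i) - f i \<le> f (Suc l) - f l" if "i \<le> l" "l < n" for i l
    using that
  proof (induction l rule: dec_induct)
    case (step l)
    then show ?case using inverse_binomial_convex[of l n] by (simp add: f_def)
  qed simp
  have "f c + (real j - real c) * (f (Suc c) - f c) \<le> f j"
  proof (cases "c \<le> j")
    case True
    then show ?thesis using assms(2)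
    proof (induction j rule: dec_induct)
      case (step l)
      then show ?case using mono[of c l] by (simp add: algebra_simps)
    qed simp
  next
    case False
    then have "j \<le> c" by simp
    then show ?thesis
    proof (induction j rule: inc_induct)
      case (step l)
      then show ?case using mono[of l c] assms(1) by (simp add: algebra_simps)
    qed simp
  qed
  then show ?thesis by (simp add: f_def)
qed

lemma SP_attained:
  obtains P where "sperner_partition_system k {..<n} P" "card P = SP n k"
proof -
  have "SP n k \<in> {card P | P. sperner_partition_system k {..<n} P}"
    unfolding SP_def
    by (rule Max_in) (auto intro!: finite_card_sperner exI[of _ "{}"] sperner_partition_system_empty)
  then show thesis using that by auto
qed

lemma SP_ge:
  assumes "finite X" "card X = n" "sperner_partition_system k X P"
  shows "card P \<le> SP n k"
  unfolding SP_eq_Max[OF assms(1,2)] using assms finite_card_sperner[OF assms(1)]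
  by (intro Max_ge) auto

lemma sum_inverse_binomial_partition:
  assumes n: "n = c * k + r" "r < k" "c < n" and p: "partition_on {..<n} p" "card p = k"
  shows "((real k - real r) + real r * (real c + 1) / (real n - real c)) / real (n choose c)
    \<le> (\<Sum>A\<in>p. 1 / real (n choose card A))"
proof -
  define D where "D = 1 / real (n choose Suc c) - 1 / real (n choose c)"
  have sub: "A \<subseteq> {..<n}" if "A \<in> p" for A using that p by (auto simp: partition_on_def)
  have "(\<Sum>A\<in>p. card A) = card (\<Union>p)"
    using p by (intro card_Union_disjoint[symmetric]) (auto simp: partition_on_def pairwise_def disjoint_def disjnt_def dest: sub finite_subset)
  then have "(\<Sum>A\<in>p. card A) = n" using p by (simp add: partition_on_def)
  then have tot: "(\<Sum>A\<in>p. real (card A)) = n" by (simp flip: of_nat_sum)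
  have "(\<Sum>A\<in>p. 1 / real (n choose c) + (real (card A) - real c) * D)
      \<le> (\<Sum>A\<in>p. 1 / real (n choose card A))"
    unfolding D_def
  proof (intro sum_mono inverse_binomial_tangent[OF n(3)])
    show "card A \<le> n" if "A \<in> p" for A
      using card_mono[OF _ sub[OF that]] by simp
  qed
  also have "(\<Sum>A\<in>p. 1 / real (n choose c) + (real (card A) - real c) * D) =
      real k / real (n choose c) + (real n - real k * real c) * D"
    using p(2) by (simp add: sum.distrib sum_distrib_right[symmetric] sum_subtractf tot)
  also have "real n - real k * real c = real r" using n(1) by simp
  also have "D = 1 / real (n choose c) * ((real c + 1) / (real n - real c) - 1)"
    unfolding D_def inverse_binomial_Suc[OF n(3)] by (simp add: algebra_simps)
  also have "real k / real (n choose c) + real r * (1 / real (n choose c) * ((real c + 1) / (real n - real c) - 1))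
     = ((real k - real r) + real r * (real c + 1) / (real n - real c)) / real (n choose c)"
    by (simp add: add_divide_distrib diff_divide_distrib algebra_simps)
  finally show ?thesis .
qed

lemma SP_le_MMS:
  assumes n: "n = c * k + r" "r < k" "c < n"
  shows "real (SP n k) \<le> MMS n k"
proof -
  obtain P where P: "sperner_partition_system k {..<n} P" "card P = SP n k"
    by (rule SP_attained)
  have part: "partition_on {..<n} p" "card p = k" if "p \<in> P" for p
    using P that by (auto simp: sperner_partition_system_def)
  have anti: "\<not> A \<subseteq> B" if "p \<in> P" "q \<in> P" "p \<noteq> q" "A \<in> p" "B \<in> q" for p q A B
    using P that unfolding sperner_partition_system_def by blast
  have sub: "P \<subseteq> Pow (Pow {..<n})"
    using part by (auto simp: partition_on_def)
  define E where "E = (real k - real r) + real r * (real c + 1) / (real n - real c)"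
  have E: "0 < E" unfolding E_def using n(2,3) by (intro add_pos_nonneg divide_nonneg_nonneg) auto
  have ch: "0 < real (n choose c)" using n(3) by simp
  have MMS: "MMS n k = real (n choose c) / E"
    using n by (simp add: MMS_def E_def Let_def)
  have "real (card P) * (E / real (n choose c)) = (\<Sum>p\<in>P. E / real (n choose c))" by simp
  also have "\<dots> \<le> (\<Sum>p\<in>P. \<Sum>A\<in>p. 1 / real (n choose card A))"
    unfolding E_def using sum_inverse_binomial_partition[OF n] part by (intro sum_mono) auto
  also have "\<dots> = (\<Sum>A\<in>\<Union>P. 1 / real (n choose card A))"
  proof (subst sum.Union_disjoint)
    show "\<forall>A\<in>P. finite A" using part finite_elements by blast
    show "\<forall>A\<in>P. \<forall>B\<in>P. A \<noteq> B \<longrightarrow> A \<inter> B = {}" using anti by blast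
  qed simp
  also have "\<dots> \<le> 1"
  proof -
    have eq: "A = B" if AB: "A \<in> \<Union>P" "B \<in> \<Union>P" "A \<subseteq> B" for A B
    proof -
      obtain p q where pq: "p \<in> P" "q \<in> P" "A \<in> p" "B \<in> q" using AB by blast
      then have "p = q" using anti AB(3) by blast
      then have "A \<noteq> {}" "A = B \<or> A \<inter> B = {}"
        using part(1)[OF pq(1)] pq by (auto simp: partition_on_def disjoint_def)
      then show ?thesis using AB(3) by blast
    qed
    show ?thesis
      using lym_inequality[of "{..<n}" "\<Union>P"] sub eq by auto
  qed
  finally have "real (card P) * E \<le> real (n choose c)" using ch by (simp add: field_simps)
  then show ?thesis using E by (simp add: MMS P(2) field_simps)
qed

subsection \<open>Asymptotics\<close>

lemma power_le_binomial_fact: "(t - c) ^ c \<le> (t choose c) * fact c"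
proof (induction c)
  case (Suc c)
  have absorb: "Suc c * (t choose Suc c) = (t - c) * (t choose c)"
  proof (cases t)
    case (Suc m)
    then show ?thesis using Suc_times_binomial[of c m] binomial_absorb_comp[of t c] by simp
  qed simp
  have "(t - Suc c) ^ Suc c \<le> (t - c) ^ Suc c" by (rule power_mono) auto
  also have "\<dots> \<le> (t - c) * ((t choose c) * fact c)" using Suc.IH by simp
  also have "\<dots> = (Suc c * (t choose Suc c)) * fact c" by (simp only: absorb mult.assoc)
  also have "\<dots> = (t choose Suc c) * fact (Suc c)" by (simp add: algebra_simps)
  finally show ?case .
qed simp

lemma SP_lower_bound:
  fixes n k c r t C :: nat and \<kappa> :: real
  defines "s \<equiv> real n / t - (2 ^ t + t + 1)"
  assumes n: "n = c * k + r" "r < k" and c: "2 \<le> c" "c \<le> C" "C \<le> t"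
    and \<kappa>: "0 < \<kappa>" "\<kappa> * n \<le> real k - real r"
    and s: "real C + 1 \<le> s" "(real C + 1) ^ (C + 1) * 2 ^ t / \<kappa> \<le> s"
  shows "s ^ c / ((real k - real r) / real (t choose c) + 1) - 1 \<le> real (SP n k)"
proof -
  define Q where "Q = t choose c"
  define d where "d = real k - real r"
  have Q: "0 < Q" using c by (simp add: Q_def)
  have d: "0 < d" using n by (simp add: d_def)
  have s0: "0 < s" using s(1) by linarith
  have kn: "k \<le> n" using n c by (cases c) auto
  define a where "a = s ^ c / (d / Q + 1)"
  define M where "M = nat \<lfloor>a\<rfloor>"
  have dQ: "0 < d / Q + 1" using d Q by (intro add_pos_pos divide_pos_pos) auto
  have a0: "0 \<le> a" using s0 dQ by (simp add: a_def)
  have M: "real M \<le> a" "a - 1 \<le> real M"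
    using a0 by (auto simp: M_def of_nat_nat)
  have "real M * (d / Q + 1) \<le> a * (d / Q + 1)"
    using M dQ by (intro mult_right_mono) auto
  also have "\<dots> = s ^ c" using dQ by (simp add: a_def)
  finally have M1: "real M * (d / Q + 1) \<le> s ^ c" .
  have M2: "real M * real k \<le> (s / (real c + 1)) ^ (c + 1)"
  proof -
    have n0: "0 < real n" using n(2) kn by linarith
    have "real M * real k \<le> s ^ c / (d / Q) * real n"
    proof (rule mult_mono)
      have "a \<le> s ^ c / (d / Q)" unfolding a_def
        using d Q s0 dQ by (intro divide_left_mono mult_pos_pos) auto
      then show "real M \<le> s ^ c / (d / Q)" using M by linarith
    qed (use kn d Q s0 in auto)
    also have "\<dots> = s ^ c * (Q * (n / d))" by simp
    also have "\<dots> \<le> s ^ c * (2 ^ t * (1 / \<kappa>))"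
    proof (intro mult_left_mono mult_mono)
      have "Q \<le> 2 ^ t" unfolding Q_def by (rule binomial_le_pow2)
      then have "real Q \<le> real (2 ^ t)" by (simp only: of_nat_le_iff)
      then show "real Q \<le> 2 ^ t" by simp
      show "n / d \<le> 1 / \<kappa>" using \<kappa> d by (simp add: field_simps d_def)
    qed (use s0 d in auto)
    also have "\<dots> \<le> s ^ c * (s / (real C + 1) ^ (C + 1))"
    proof (intro mult_left_mono)
      define W where "W = (real C + 1) ^ (C + 1)"
      have "0 < W" unfolding W_def by (intro zero_less_power) simp
      moreover have "W * 2 ^ t / \<kappa> \<le> s" using s(2) by (simp only: W_def)
      ultimately have "2 ^ t * (1 / \<kappa>) \<le> s / W" by (simp add: pos_le_divide_eq mult.commute)
      then show "2 ^ t * (1 / \<kappa>) \<le> s / (real C + 1) ^ (C + 1)" by (simp only: W_def)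
    qed (use s0 in simp)
    also have "\<dots> \<le> s ^ c * (s / (real c + 1) ^ (c + 1))"
    proof -
      have "(real c + 1) ^ (c + 1) \<le> (real C + 1) ^ (c + 1)" using c by (intro power_mono) auto
      also have "\<dots> \<le> (real C + 1) ^ (C + 1)" using c by (intro power_increasing) auto
      finally show ?thesis using s0 by (intro mult_left_mono divide_left_mono) auto
    qed
    also have "\<dots> = (s / (real c + 1)) ^ (c + 1)" by (simp add: power_divide)
    finally show ?thesis .
  qed
  have "(t - 1) choose (c - 1) \<le> 2 ^ t"
    using binomial_le_pow2[of "t - 1" "c - 1"] power_increasing[of "t - 1" t "2::nat"] by linarith
  then have "((t - 1) choose (c - 1)) + (c + 1) \<le> 2 ^ t + t + 1" using c by linarith
  then have "real (((t - 1) choose (c - 1)) + (c + 1)) \<le> real (2 ^ t + t + 1)"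
    by (simp only: of_nat_le_iff)
  then have s2: "s \<le> real n / t - real ((t - 1) choose (c - 1)) - (real c + 1)"
    unfolding s_def by (simp only: of_nat_add of_nat_1)
  have s1: "real c + 1 \<le> s" using s(1) c by simp
  obtain X :: "(nat \<times> nat) set" and P where "finite X" "card X = n" "card P = M"
    "sperner_partition_system k X P"
    using ex_sperner_partition_system[of n c k r t s M] n c s1 s2 M1 M2
    unfolding d_def Q_def by (auto simp: add.commute)
  then have "M \<le> SP n k" using SP_ge by blast
  then show ?thesis using M(2) by (simp add: a_def d_def Q_def)
qed

lemma MMS_bound:
  assumes n: "n = c * k + r" "r < k" "c < n"
  shows "MMS n k \<le> real n ^ c / (fact c * (real k - real r))" and "0 < MMS n k"
proof -
  define E where "E = (real k - real r) + real r * (real c + 1) / (real n - real c)"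
  have d: "0 < real k - real r" using n(2) by simp
  have E: "real k - real r \<le> E" using n(3) by (simp add: E_def)
  have MMS: "MMS n k = real (n choose c) / E"
    using n by (simp add: MMS_def E_def Let_def)
  have "(n choose c) * fact c \<le> n ^ c" by (rule binomial_fact_pow)
  then have "real ((n choose c) * fact c) \<le> real (n ^ c)" by (simp only: of_nat_le_iff)
  then have "real (n choose c) \<le> real n ^ c / fact c" by (simp add: field_simps)
  then have "real (n choose c) / E \<le> (real n ^ c / fact c) / (real k - real r)"
    using d E by (intro frac_le) auto
  then show "MMS n k \<le> real n ^ c / (fact c * (real k - real r))" by (simp add: MMS)
  show "0 < MMS n k" using d E n(3) by (simp add: MMS zero_less_binomial)
qed

lemma SP_ge_times_MMS:
  fixes n k c r t C :: nat and \<kappa> :: real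
  assumes n: "n = c * k + r" "r < k" "c < n" "2 * k \<le> n" and c: "2 \<le> c" "c \<le> C" "C \<le> t"
    and \<kappa>: "0 < \<kappa>" "\<kappa> * n \<le> real k - real r"
    and s: "real C + 1 \<le> real n / t - (2 ^ t + t + 1)"
      "(real C + 1) ^ (C + 1) * 2 ^ t / \<kappa> \<le> real n / t - (2 ^ t + t + 1)"
    and \<delta>: "0 \<le> \<delta>"
      "\<delta> \<le> (1 - 2 ^ t / (\<kappa> * n)) * ((1 - (2 ^ t + t + 1) * t / n) * (1 - C / t)) ^ C - fact C / n"
  shows "\<delta> * MMS n k \<le> real (SP n k)"
proof -
  define d where "d = real k - real r"
  define B where "B = real n ^ c / (fact c * d)"
  define Q where "Q = t choose c"
  define s where "s = real n / t - (2 ^ t + t + 1)"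
  define \<alpha> where "\<alpha> = 1 - (2 ^ t + t + 1) * t / n"
  have d: "0 < d" using n by (simp add: d_def)
  have Q: "0 < Q" using c by (simp add: Q_def)
  have n0: "0 < real n" using n(3) by simp
  have t0: "0 < real t" using c by simp
  have s0: "0 < s" using s(1) by (simp add: s_def)
  have s_eq: "s = n / t * \<alpha>" using n0 t0 by (simp add: s_def \<alpha>_def field_simps)
  have \<alpha>: "0 \<le> \<alpha>" "\<alpha> \<le> 1"
  proof -
    have "0 < real n / t" using n0 t0 by simp
    with s0 show "0 \<le> \<alpha>" unfolding s_eq by (simp only: zero_less_mult_pos less_imp_le)
    show "\<alpha> \<le> 1" using n0 t0 by (simp add: \<alpha>_def)
  qed
  have B0: "0 < B" using n0 d by (simp add: B_def)
  have "B * ((1 - 2 ^ t / (\<kappa> * n)) * (\<alpha> * (1 - C / t)) ^ C) \<le> B * (d / (d + Q) * (\<alpha> * (1 - c / t)) ^ c)"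
  proof (intro mult_left_mono mult_mono)
    have "Q \<le> 2 ^ t" unfolding Q_def by (rule binomial_le_pow2)
    then have "real Q \<le> real (2 ^ t)" by (simp only: of_nat_le_iff)
    then have "Q / d \<le> 2 ^ t / (\<kappa> * n)"
      using \<kappa> n0 d by (intro frac_le) (auto simp: d_def)
    moreover have "1 - Q / d \<le> d / (d + Q)"
      using d Q by (simp add: field_simps)
    ultimately show "1 - 2 ^ t / (\<kappa> * n) \<le> d / (d + Q)" by linarith
    have "(\<alpha> * (1 - C / t)) ^ C \<le> (\<alpha> * (1 - C / t)) ^ c"
      using \<alpha> c t0 by (intro power_decreasing) (auto intro!: mult_nonneg_nonneg mult_le_one)
    also have "\<dots> \<le> (\<alpha> * (1 - c / t)) ^ c"
      using \<alpha> c t0 by (intro power_mono mult_left_mono) (auto simp: divide_right_mono)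
    finally show "(\<alpha> * (1 - C / t)) ^ C \<le> (\<alpha> * (1 - c / t)) ^ c" .
    show "0 \<le> (\<alpha> * (1 - C / t)) ^ C" using \<alpha> c t0 by simp
  qed (use B0 d in auto)
  also have "\<dots> \<le> s ^ c / (d / Q + 1)"
  proof -
    have "real ((t - c) ^ c) \<le> real (Q * fact c)"
      unfolding Q_def by (simp only: of_nat_le_iff power_le_binomial_fact)
    then have Qc: "(real t - c) ^ c / fact c \<le> Q"
      using c by (simp add: of_nat_diff field_simps)
    have "(\<alpha> * (1 - c / t)) ^ c = (s / n) ^ c * (real t - c) ^ c"
      unfolding s_eq power_mult_distrib[symmetric] using n0 t0 by (simp add: field_simps)
    then have "B * (d / (d + Q) * (\<alpha> * (1 - c / t)) ^ c) = s ^ c / (d + Q) * ((real t - c) ^ c / fact c)"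
      using n0 d by (simp add: B_def power_divide)
    also have "\<dots> \<le> s ^ c / (d + Q) * Q"
      using Qc s0 d by (intro mult_left_mono) auto
    also have "\<dots> = s ^ c / (d / Q + 1)" using Q d by (simp add: field_simps)
    finally show ?thesis .
  qed
  also have "\<dots> \<le> real (SP n k) + 1"
    using SP_lower_bound[OF n(1,2) c \<kappa> s] by (simp add: s_def d_def Q_def)
  finally have 1: "B * ((1 - 2 ^ t / (\<kappa> * n)) * (\<alpha> * (1 - C / t)) ^ C) \<le> real (SP n k) + 1" .
  have 2: "1 \<le> B * (fact C / n)"
  proof -
    have dn: "d \<le> n" using n(4) by (simp add: d_def)
    have "fact c * d \<le> fact C * real n"
      using dn c d fact_mono[of c C, where 'a=real] by (intro mult_mono) auto
    also have "\<dots> * n = fact C * real n ^ 2" by (simp add: power2_eq_square)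
    also have "\<dots> \<le> fact C * real n ^ c"
      using n0 c by (intro mult_left_mono power_increasing) auto
    finally have "fact c * d * n \<le> fact C * real n ^ c" using n0 by simp
    then show ?thesis using n0 d by (simp add: B_def field_simps)
  qed
  have "\<delta> * MMS n k \<le> \<delta> * B"
    using MMS_bound[OF n(1-3)] \<delta>(1) by (intro mult_left_mono) (auto simp: B_def d_def)
  also have "\<dots> \<le> ((1 - 2 ^ t / (\<kappa> * n)) * (\<alpha> * (1 - C / t)) ^ C - fact C / n) * B"
    using \<delta>(2) B0 by (intro mult_right_mono) (auto simp: \<alpha>_def)
  also have "\<dots> \<le> real (SP n k)"
    using 1 2 by (simp add: algebra_simps)
  finally show ?thesis .
qed

lemma eventually_SP_ge:
  fixes \<kappa> \<delta> :: real
  assumes \<kappa>: "0 < \<kappa>" and \<delta>: "0 \<le> \<delta>" "\<delta> < 1"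
  shows "eventually (\<lambda>n. \<forall>k c r. n = c * k + r \<longrightarrow> r < k \<longrightarrow> 2 * k \<le> n \<longrightarrow>
    \<kappa> * n \<le> real k - real r \<longrightarrow> c < n \<and> \<delta> * MMS n k \<le> real (SP n k)) sequentially"
proof -
  define C where "C = nat \<lceil>1 / \<kappa>\<rceil>"
  have "(\<lambda>t::nat. (1 - real C / t) ^ C) \<longlonglongrightarrow> (1 - 0) ^ C"
    by (intro tendsto_intros tendsto_divide_0[OF tendsto_const] filterlim_real_at_infinity_sequentially[THEN filterlim_mono])
      auto
  then have "eventually (\<lambda>t::nat. \<delta> < (1 - real C / t) ^ C) sequentially"
    using \<delta> by (intro order_tendstoD(1)) auto
  then have "eventually (\<lambda>t::nat. \<delta> < (1 - real C / t) ^ C \<and> C \<le> t \<and> 0 < t) sequentially"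
    by (intro eventually_conj eventually_ge_at_top eventually_gt_at_top)
  then obtain t where t: "\<delta> < (1 - real C / t) ^ C" "C \<le> t" "0 < t"
    by (auto dest!: eventually_happens)
  have inv: "(\<lambda>n. a / real n) \<longlonglongrightarrow> 0" for a
    by (rule lim_const_over_n)
  have "(\<lambda>n::nat. (1 - 2 ^ t / \<kappa> / n) * ((1 - (2 ^ t + t + 1) * t / n) * (1 - C / t)) ^ C - fact C / n)
      \<longlonglongrightarrow> (1 - 0) * ((1 - 0) * (1 - C / t)) ^ C - 0"
    by (intro tendsto_intros inv)
  then have ev1: "eventually (\<lambda>n::nat. \<delta> < (1 - 2 ^ t / \<kappa> / n) *
      ((1 - (2 ^ t + t + 1) * t / n) * (1 - C / t)) ^ C - fact C / n) sequentially"
    using t by (intro order_tendstoD(1)) auto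
  have ev2: "eventually (\<lambda>n::nat. a \<le> real n / t - b) sequentially" for a b
  proof -
    have "eventually (\<lambda>n::nat. (a + b) * t \<le> real n) sequentially"
      using filterlim_real_sequentially by (simp add: filterlim_at_top)
    then show ?thesis using t(3) by (simp add: field_simps)
  qed
  show ?thesis
    using ev1 ev2[of "real C + 1" "2 ^ t + t + 1"]
      ev2[of "(real C + 1) ^ (C + 1) * 2 ^ t / \<kappa>" "2 ^ t + t + 1"] eventually_gt_at_top[of C]
  proof eventually_elim
    case (elim n)
    show ?case
    proof (intro allI impI)
      fix k c r assume h: "n = c * k + r" "r < k" "2 * k \<le> n" "\<kappa> * n \<le> real k - real r"
      have n0: "0 < n" using h by linarith
      have c2: "2 \<le> c"
      proof (rule ccontr)
        assume "\<not> 2 \<le> c"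
        then have "c * k \<le> 1 * k" by (intro mult_right_mono) auto
        then show False using h by linarith
      qed
      have "real c * (\<kappa> * n) \<le> real c * k" using h by (intro mult_left_mono) auto
      also have "\<dots> \<le> n" using h(1) by simp
      finally have "real c * \<kappa> \<le> 1" using n0 by (simp add: field_simps)
      then have "real c \<le> 1 / \<kappa>" using \<kappa> by (simp add: field_simps)
      then have cC: "c \<le> C" unfolding C_def by linarith
      have cn: "c < n" using cC elim(4) by simp
      have "\<delta> * MMS n k \<le> real (SP n k)"
        using elim h by (intro SP_ge_times_MMS[of n c k r C t \<kappa> \<delta>] cn c2 cC t \<kappa> \<delta>) auto
      then show "c < n \<and> \<delta> * MMS n k \<le> real (SP n k)" using cn by simp
    qed
  qed
qed

theorem theorem2:
  fixes n k c r :: "nat \<Rightarrow> nat"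
  assumes "filterlim n at_top sequentially"
    and "\<And>i. n i = c i * k i + r i"
    and "\<And>i. r i < k i"
    and "\<And>i. real (k i) \<le> real (n i) / 2"
    and "(\<lambda>i. real (k i) - real (r i)) \<in> \<Theta>[sequentially](\<lambda>i. real (n i))"
  shows "(\<lambda>i. real (SP (n i) (k i))) \<sim>[sequentially] (\<lambda>i. MMS (n i) (k i))"
proof -
  obtain \<kappa> where \<kappa>: "0 < \<kappa>"
    "eventually (\<lambda>i. \<kappa> * norm (real (n i)) \<le> norm (real (k i) - real (r i))) sequentially"
    using landau_omega.bigE[OF bigthetaD2[OF assms(5)]] by blast
  have k2: "2 * k i \<le> n i" for i
  proof -
    have "real (2 * k i) \<le> real (n i)" using assms(4)[of i] by simp
    then show ?thesis by (simp only: of_nat_le_iff)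
  qed
  have ev: "eventually (\<lambda>i. 0 < MMS (n i) (k i) \<and> \<delta> \<le> SP (n i) (k i) / MMS (n i) (k i) \<and>
      SP (n i) (k i) / MMS (n i) (k i) \<le> 1) sequentially" if \<delta>: "0 \<le> \<delta>" "\<delta> < 1" for \<delta>
    using eventually_compose_filterlim[OF eventually_SP_ge[OF \<kappa>(1) \<delta>] assms(1)] \<kappa>(2)
  proof eventually_elim
    case (elim i)
    have "\<kappa> * n i \<le> real (k i) - real (r i)" using elim(2) assms(3)[of i] by simp
    then have *: "c i < n i" "\<delta> * MMS (n i) (k i) \<le> SP (n i) (k i)"
      using elim(1) assms(2,3) k2 by blast+
    moreover have "0 < MMS (n i) (k i)"
      using MMS_bound(2)[OF assms(2,3) *(1)] .
    moreover have "SP (n i) (k i) \<le> MMS (n i) (k i)"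
      using SP_le_MMS[OF assms(2,3) *(1)] .
    ultimately show ?case by (simp add: field_simps)
  qed
  have "(\<lambda>i. SP (n i) (k i) / MMS (n i) (k i)) \<longlonglongrightarrow> 1"
  proof (rule order_tendstoI)
    fix a :: real assume "a < 1"
    then obtain b where b: "0 \<le> b" "b < 1" "a < b"
      using dense[of "max 0 a" 1] by (auto intro: less_imp_le)
    from ev[OF b(1,2)] show "eventually (\<lambda>i. a < SP (n i) (k i) / MMS (n i) (k i)) sequentially"
      by eventually_elim (use b(3) in linarith)
  next
    fix a :: real assume "1 < a"
    have "eventually (\<lambda>i. SP (n i) (k i) / MMS (n i) (k i) \<le> 1) sequentially"
      using ev[OF order_refl zero_less_one] by eventually_elim simp
    then show "eventually (\<lambda>i. SP (n i) (k i) / MMS (n i) (k i) < a) sequentially"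
      by eventually_elim (use \<open>1 < a\<close> in linarith)
  qed
  then show ?thesis by (rule asymp_equivI')
qed

end
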